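(* Let $(R,\mathfrak{m},k)$ be a Noetherian local ring with infinite residue field $k$. Let $I$ be an ideal of $R$ and let $M\subseteq N$ be finitely generated $R$-modules. Then there exist an integer $t>0$ and a nonempty Zariski open subset $U$ of the $k$-vector space $I/\mathfrak{m}I$ such that for every $x\in I$ whose image in $I/\mathfrak{m}I$ lies in $U$, and for every ideal $J$ of $R$ with $x\in J\subseteq I$, we have $$I^nM:_N J = (0:_N J)+I^{n-1}M\quad\text{for every } n\geq t.$$
   Context: For a submodule $L\subseteq N$ and an ideal $J$ of $R$, $L:_N J=\{u\in N : Ju\subseteq L\}$; in particular $0:_N J=\{u\in N: Ju=0\}$. The phrase "for a general element $x$ of $I$" means: for all $x\in I$ whose image in $I/\mathfrak{m}I$ lies in a suitable nonempty Zariski open subset of $I/\mathfrak{m}I$. *)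

theory Defs
  imports Complex_Main
begin

text \<open>Commutative ring R is modelled by a type 'a :: comm_ring_1; R-modules by a
  scalar multiplication scale :: 'a => 'b => 'b satisfying the library locale module,
  and the finitely generated modules M \<subseteq> N as submodules of that ambient module.\<close>

definition is_ideal :: "'a::comm_ring_1 set \<Rightarrow> bool" where
  "is_ideal J \<longleftrightarrow> 0 \<in> J \<and> (\<forall>a\<in>J. \<forall>b\<in>J. a + b \<in> J) \<and> (\<forall>r. \<forall>a\<in>J. r * a \<in> J)"

definition ideal_gen :: "'a::comm_ring_1 set \<Rightarrow> 'a set" where
  "ideal_gen S = \<Inter>{J. is_ideal J \<and> S \<subseteq> J}"

definition noetherian_ring :: "'a::comm_ring_1 itself \<Rightarrow> bool" where
  "noetherian_ring _ \<longleftrightarrow> (\<forall>J::'a set. is_ideal J \<longrightarrow> (\<exists>F. finite F \<and> J = ideal_gen F))"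

definition maximal_ideal :: "'a::comm_ring_1 set \<Rightarrow> bool" where
  "maximal_ideal P \<longleftrightarrow> is_ideal P \<and> P \<noteq> UNIV \<and>
     (\<forall>J. is_ideal J \<longrightarrow> P \<subseteq> J \<longrightarrow> J = P \<or> J = UNIV)"

definition local_ring_max :: "'a::comm_ring_1 set \<Rightarrow> bool" where
  "local_ring_max m \<longleftrightarrow> maximal_ideal m \<and> (\<forall>P. maximal_ideal P \<longrightarrow> P = m)"

definition residue_field :: "'a::comm_ring_1 set \<Rightarrow> 'a set set" where
  "residue_field m = (\<lambda>r. {r + y | y. y \<in> m}) ` UNIV"

primrec ideal_pow :: "'a::comm_ring_1 set \<Rightarrow> nat \<Rightarrow> 'a set" where
  "ideal_pow I 0 = UNIV"
| "ideal_pow I (Suc n) = ideal_gen {a * b | a b. a \<in> I \<and> b \<in> ideal_pow I n}"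

definition ideal_smult :: "('a::comm_ring_1 \<Rightarrow> 'b::ab_group_add \<Rightarrow> 'b) \<Rightarrow> 'a set \<Rightarrow> 'b set \<Rightarrow> 'b set" where
  "ideal_smult scale J L = module.span scale {scale r u | r u. r \<in> J \<and> u \<in> L}"

definition fg_submodule :: "('a::comm_ring_1 \<Rightarrow> 'b::ab_group_add \<Rightarrow> 'b) \<Rightarrow> 'b set \<Rightarrow> bool" where
  "fg_submodule scale N \<longleftrightarrow> (\<exists>F. finite F \<and> N = module.span scale F)"

definition colon_mod :: "('a::comm_ring_1 \<Rightarrow> 'b::ab_group_add \<Rightarrow> 'b) \<Rightarrow> 'b set \<Rightarrow> 'b set \<Rightarrow> 'a set \<Rightarrow> 'b set" where
  "colon_mod scale L N J = {u \<in> N. \<forall>r\<in>J. scale r u \<in> L}"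

definition submod_sum :: "'b::ab_group_add set \<Rightarrow> 'b set \<Rightarrow> 'b set" where
  "submod_sum A B = {a + b | a b. a \<in> A \<and> b \<in> B}"

text \<open>A function phi : I -> R representing an R-linear map I -> R/m, i.e. (since m kills
  R/m) a k-linear functional on I/mI.\<close>
definition lin_functional :: "'a::comm_ring_1 set \<Rightarrow> 'a set \<Rightarrow> ('a \<Rightarrow> 'a) \<Rightarrow> bool" where
  "lin_functional m I phi \<longleftrightarrow>
     (\<forall>x\<in>I. \<forall>y\<in>I. phi (x + y) - phi x - phi y \<in> m) \<and>
     (\<forall>r. \<forall>x\<in>I. phi (r * x) - r * phi x \<in> m)"

text \<open>Representatives of polynomial functions I/mI -> k: the k-algebra generated by the
  linear functionals (constants, linear functionals, sums, products), taken mod m.\<close>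
inductive_set polyfun :: "'a::comm_ring_1 set \<Rightarrow> 'a set \<Rightarrow> ('a \<Rightarrow> 'a) set"
  for m I where
  const: "(\<lambda>x. c) \<in> polyfun m I"
| lin: "lin_functional m I phi \<Longrightarrow> phi \<in> polyfun m I"
| add: "f \<in> polyfun m I \<Longrightarrow> g \<in> polyfun m I \<Longrightarrow> (\<lambda>x. f x + g x) \<in> polyfun m I"
| mult: "f \<in> polyfun m I \<Longrightarrow> g \<in> polyfun m I \<Longrightarrow> (\<lambda>x. f x * g x) \<in> polyfun m I"

text \<open>Preimage in I of the Zariski open subset of I/mI that is the complement of the common
  zero locus of the family F of polynomial functions.\<close>
definition zariski_open_pre :: "'a::comm_ring_1 set \<Rightarrow> 'a set \<Rightarrow> ('a \<Rightarrow> 'a) set \<Rightarrow> 'a set" where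
  "zariski_open_pre m I F = {x \<in> I. \<exists>f\<in>F. f x \<notin> m}"

end

theory Submission
  imports Defs "HOL-Library.Function_Algebras"
begin

text \<open>
Applying prime avoidance to the graded modules \<open>\<Oplus> I\<^sup>j M / I\<^sup>j\<^sup>+\<^sup>1 M\<close> and \<open>\<Oplus> I\<^sup>j N / (M \<inter> I\<^sup>j N)\<close>
shows that for general \<open>x\<close> and every \<open>n\<close>, \<open>x u \<in> I\<^sup>n M\<close> implies \<open>I\<^sup>p u \<subseteq> I\<^sup>n\<^sup>+\<^sup>p\<^sup>-\<^sup>1 M\<close> for some \<open>p\<close>.
This last condition no longer involves \<open>x\<close>, so an Artin-Rees argument with one fixed
superficial element \<open>x\<^sub>0\<close> gives a uniform bound \<open>t\<close> beyond which it forces \<open>u \<in> I\<^sup>n\<^sup>-\<^sup>1 M + K\<close>, where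
\<open>K\<close> is the \<open>I\<close>-power torsion of \<open>N\<close>. If moreover \<open>J u \<subseteq> I\<^sup>n M\<close>, the \<open>K\<close>-component \<open>k\<close> of \<open>u\<close> satisfies
\<open>J k \<subseteq> I\<^sup>n M \<inter> K\<close>, which vanishes for large \<open>n\<close> by Artin-Rees again. All Noetherianity statements
about Rees modules are phrased as ascending chain conditions for subgroups stable under a
set of commuting operators.
\<close>

section \<open>Chain conditions for modules with operators\<close>

text \<open>Operators are plain functions, so ideals, submodules and submodules over a Rees algebra
  are instances of one notion, and no graded ring has to be built as a type.\<close>

definition op_sub :: "('b \<Rightarrow> 'b) set \<Rightarrow> 'b::ab_group_add set \<Rightarrow> bool" where
  "op_sub S U \<longleftrightarrow> 0 \<in> U \<and> (\<forall>x\<in>U. \<forall>y\<in>U. x - y \<in> U) \<and> (\<forall>X\<in>S. \<forall>x\<in>U. X x \<in> U)"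

lemma op_subI:
  assumes "0 \<in> U" "\<And>x y. x \<in> U \<Longrightarrow> y \<in> U \<Longrightarrow> x - y \<in> U" "\<And>X x. X \<in> S \<Longrightarrow> x \<in> U \<Longrightarrow> X x \<in> U"
  shows "op_sub S U"
  using assms unfolding op_sub_def by blast

lemma op_subD:
  assumes "op_sub S U"
  shows "0 \<in> U" "x \<in> U \<Longrightarrow> y \<in> U \<Longrightarrow> x - y \<in> U" "X \<in> S \<Longrightarrow> x \<in> U \<Longrightarrow> X x \<in> U"
  using assms unfolding op_sub_def by blast+

lemma op_sub_minus: "op_sub S U \<Longrightarrow> x \<in> U \<Longrightarrow> - x \<in> U"
  using op_subD(1)[of S U] op_subD(2)[of S U 0 x] by simp

lemma op_sub_add: "op_sub S U \<Longrightarrow> x \<in> U \<Longrightarrow> y \<in> U \<Longrightarrow> x + y \<in> U"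
  using op_subD(2)[of S U x "- y"] op_sub_minus[of S U y] by simp

definition acc :: "('b \<Rightarrow> 'b) set \<Rightarrow> 'b::ab_group_add set \<Rightarrow> bool" where
  "acc S L \<longleftrightarrow> (\<forall>U. (\<forall>n. op_sub S (U n) \<and> U n \<subseteq> L) \<longrightarrow> mono U \<longrightarrow> (\<exists>t. \<forall>n\<ge>t. U n = U (t::nat)))"

lemma accD:
  assumes "acc S L" "\<And>n. op_sub S (U n)" "\<And>n. U n \<subseteq> L" "mono U"
  obtains t :: nat where "\<And>n. n \<ge> t \<Longrightarrow> U n = U t"
  using assms unfolding acc_def by meson

text \<open>Preimages in \<open>A\<close> turn a chain in the image into a chain in
  \<open>A\<close>, and taking images recovers the first chain. An operator only has to be matched
  by one of \<open>S'\<close> on \<open>A\<close>.\<close>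

lemma acc_image:
  fixes f :: "'b::ab_group_add \<Rightarrow> 'c::ab_group_add"
  assumes "acc S A" "op_sub S A" "additive f"
    and hom: "\<And>X. X \<in> S \<Longrightarrow> \<exists>X'\<in>S'. \<forall>a\<in>A. f (X a) = X' (f a)"
  shows "acc S' (f ` A)"
  unfolding acc_def
proof (intro allI impI)
  fix U :: "nat \<Rightarrow> 'c set"
  assume U: "\<forall>n. op_sub S' (U n) \<and> U n \<subseteq> f ` A" and mono: "mono U"
  interpret additive f by fact
  note sub = op_subD[OF conjunct1[OF spec[OF U]]]
  let ?V = "\<lambda>n. {a \<in> A. f a \<in> U n}"
  have "op_sub S (?V n)" for n
  proof (rule op_subI)
    show "X x \<in> ?V n" if "X \<in> S" "x \<in> ?V n" for X x
      using hom[OF that(1)] that U op_subD(3)[OF assms(2)] op_subD(3)[of S' "U n"] by force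
  qed (use sub(1,2) op_subD(1,2)[OF assms(2)] in \<open>auto simp: zero diff\<close>)
  moreover have "mono ?V" using mono by (auto simp: mono_def)
  ultimately obtain t where t: "\<And>n. n \<ge> t \<Longrightarrow> ?V n = ?V t"
    using accD[OF assms(1), of ?V] by auto
  have "U n = f ` ?V n" for n using U by blast
  then show "\<exists>t. \<forall>n\<ge>t. U n = U t" using t by metis
qed

text \<open>A stable subgroup of the sum is controlled by the \<open>A\<close>-components of its
  elements and by its trace on \<open>B\<close>. The sum need not be direct, so a component is only
  required to have some partner in \<open>B\<close>.\<close>

lemma acc_add:
  assumes "acc S A" "acc S B" "op_sub S A" "op_sub S B" "\<And>X. X \<in> S \<Longrightarrow> additive X"
  shows "acc S {a + b | a b. a \<in> A \<and> b \<in> B}"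
  unfolding acc_def
proof (intro allI impI)
  fix U :: "nat \<Rightarrow> 'a set"
  assume U: "\<forall>n. op_sub S (U n) \<and> U n \<subseteq> {a + b | a b. a \<in> A \<and> b \<in> B}" and mono: "mono U"
  note sub = op_subD[OF conjunct1[OF spec[OF U]]]
  let ?V = "\<lambda>n. {a \<in> A. \<exists>b\<in>B. a + b \<in> U n}" and ?W = "\<lambda>n. U n \<inter> B"
  have "op_sub S (?V n)" for n
  proof (rule op_subI)
    show "0 \<in> ?V n" using op_subD(1)[OF assms(3)] op_subD(1)[OF assms(4)] sub(1) by force
    fix x y assume x: "x \<in> ?V n" and y: "y \<in> ?V n"
    then obtain b c where bc: "b \<in> B" "c \<in> B" "x + b \<in> U n" "y + c \<in> U n" by blast
    have "(x + b) - (y + c) \<in> U n" by (rule sub(2)) fact+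
    moreover have "(x + b) - (y + c) = (x - y) + (b - c)" by simp
    ultimately show "x - y \<in> ?V n"
      using bc x y op_subD(2)[OF assms(3)] op_subD(2)[OF assms(4)] by (metis (mono_tags, lifting) mem_Collect_eq)
  next
    fix X x assume X: "X \<in> S" and x: "x \<in> ?V n"
    then obtain b where b: "b \<in> B" "x + b \<in> U n" by blast
    have "X x + X b \<in> U n" using sub(3)[OF X b(2)] additive.add[OF assms(5)[OF X]] by simp
    then show "X x \<in> ?V n" using op_subD(3)[OF assms(3) X] op_subD(3)[OF assms(4) X b(1)] x by blast
  qed
  moreover have "mono ?V" using mono unfolding mono_def by blast
  ultimately obtain t1 where t1: "\<And>n. n \<ge> t1 \<Longrightarrow> ?V n = ?V t1"
    using accD[OF assms(1), of ?V] by auto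
  have "op_sub S (?W n)" for n
    using sub assms(4) by (auto simp: op_sub_def)
  moreover have "mono ?W" using mono unfolding mono_def by blast
  ultimately obtain t2 where t2: "\<And>n. n \<ge> t2 \<Longrightarrow> ?W n = ?W t2"
    using accD[OF assms(2), of ?W] by auto
  have "U n \<subseteq> U (max t1 t2)" if "n \<ge> max t1 t2" for n
  proof
    fix u assume u: "u \<in> U n"
    then obtain a b where ab: "u = a + b" "a \<in> A" "b \<in> B" using U by blast
    \<comment> \<open>Some \<open>a + c\<close> already lies in the stable term, and the error
      \<open>u - (a + c) = b - c\<close> lies in \<open>B\<close>, where the traces have
      stabilized.\<close>
    then have "a \<in> ?V n" using u by blast
    then have "a \<in> ?V (max t1 t2)" using t1[of n] t1[of "max t1 t2"] that by (metis (lifting) max.cobounded1 max.boundedE)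
    then obtain c where c: "c \<in> B" "a + c \<in> U (max t1 t2)" by blast
    then have "a + c \<in> U n" using monoD[OF mono that] by blast
    then have "u - (a + c) \<in> U n" using sub(2) u by blast
    then have "b - c \<in> ?W n" using ab c op_subD(2)[OF assms(4)] by auto
    then have "b - c \<in> U (max t1 t2)" using t2[of n] t2[of "max t1 t2"] that by auto
    from op_sub_add[OF conjunct1[OF spec[OF U]] c(2) this] show "u \<in> U (max t1 t2)" by (simp add: ab)
  qed
  then have "U n = U (max t1 t2)" if "n \<ge> max t1 t2" for n
    using that mono by (metis antisym monoD)
  then show "\<exists>t. \<forall>n\<ge>t. U n = U t" by blast
qed

lemma op_sub_sum_set:
  assumes "op_sub S A" "op_sub S B" "\<And>X. X \<in> S \<Longrightarrow> additive X"
  shows "op_sub S {a + b | a b. a \<in> A \<and> b \<in> B}"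
proof (rule op_subI)
  show "0 \<in> {a + b | a b. a \<in> A \<and> b \<in> B}"
    using op_subD(1)[OF assms(1)] op_subD(1)[OF assms(2)] by force
  fix x y assume "x \<in> {a + b | a b. a \<in> A \<and> b \<in> B}" "y \<in> {a + b | a b. a \<in> A \<and> b \<in> B}"
  then obtain a b c d where *: "x = a + b" "y = c + d" "a \<in> A" "b \<in> B" "c \<in> A" "d \<in> B" by blast
  have "x - y = (a - c) + (b - d)" using * by simp
  then show "x - y \<in> {a + b | a b. a \<in> A \<and> b \<in> B}"
    using * op_subD(2)[OF assms(1)] op_subD(2)[OF assms(2)] by blast
next
  fix X x assume "X \<in> S" "x \<in> {a + b | a b. a \<in> A \<and> b \<in> B}"
  then show "X x \<in> {a + b | a b. a \<in> A \<and> b \<in> B}"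
    using op_subD(3)[OF assms(1)] op_subD(3)[OF assms(2)] additive.add[OF assms(3)] by fastforce
qed

section \<open>Polynomials in a commuting operator, and Hilbert's basis theorem\<close>

primrec op_span :: "('b \<Rightarrow> 'b) \<Rightarrow> 'b::ab_group_add set \<Rightarrow> nat \<Rightarrow> 'b set" where
  "op_span X L 0 = {0}"
| "op_span X L (Suc n) = {y + (X ^^ n) l | y l. y \<in> op_span X L n \<and> l \<in> L}"

context
  fixes S :: "('b::ab_group_add \<Rightarrow> 'b) set" and X :: "'b \<Rightarrow> 'b" and L :: "'b set"
  assumes L: "op_sub S L" and addX: "additive X" and addS: "\<And>Y. Y \<in> S \<Longrightarrow> additive Y"
    and comm: "\<And>Y u. Y \<in> S \<Longrightarrow> Y (X u) = X (Y u)"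
begin

private lemma additive_pow: "additive (X ^^ n)"
  by (induction n) (use addX in \<open>auto simp: additive_def\<close>)

private lemma comm_pow: "Y \<in> S \<Longrightarrow> Y ((X ^^ n) u) = (X ^^ n) (Y u)"
  by (induction n) (auto simp: comm)

lemma op_sub_op_span: "op_sub S (op_span X L n)"
proof (induction n)
  case 0
  then show ?case by (auto simp: op_sub_def addS additive.zero)
next
  case (Suc n)
  have "op_sub S ((X ^^ n) ` L)"
  proof (rule op_subI)
    show "0 \<in> (X ^^ n) ` L" using op_subD(1)[OF L] additive.zero[OF additive_pow] by force
    show "x - y \<in> (X ^^ n) ` L" if "x \<in> (X ^^ n) ` L" "y \<in> (X ^^ n) ` L" for x y
      using that op_subD(2)[OF L] by (auto simp: additive.diff[OF additive_pow, symmetric])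
    show "Y x \<in> (X ^^ n) ` L" if "Y \<in> S" "x \<in> (X ^^ n) ` L" for Y x
      using that op_subD(3)[OF L] by (auto simp: comm_pow)
  qed
  from op_sub_sum_set[OF Suc this addS] show ?case
    by (rule back_subst) auto
qed

lemma op_span_shift: "u \<in> op_span X L n \<Longrightarrow> X u \<in> op_span X L (Suc n)"
proof (induction n arbitrary: u)
  case 0
  then show ?case using op_subD(1)[OF L] by (auto simp: additive.zero[OF addX])
next
  case (Suc n)
  then obtain y l where "u = y + (X ^^ n) l" "y \<in> op_span X L n" "l \<in> L" by auto
  then have "X u = X y + (X ^^ Suc n) l" "X y \<in> op_span X L (Suc n)" "l \<in> L"
    using Suc.IH[of y] additive.add[OF addX] by auto
  then show ?case unfolding op_span.simps(2)[of X L "Suc n"] by blast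
qed

lemma op_span_mono: "mono (op_span X L)"
proof (rule mono_iff_le_Suc[THEN iffD2], rule allI, rule subsetI)
  fix n u assume "u \<in> op_span X L n"
  then show "u \<in> op_span X L (Suc n)"
    using op_subD(1)[OF L] additive.zero[OF additive_pow] by force
qed

lemma subset_op_span: "L \<subseteq> (\<Union>n. op_span X L n)"
proof
  fix l assume "l \<in> L"
  then have "l \<in> op_span X L 1" by auto
  then show "l \<in> (\<Union>n. op_span X L n)" by blast
qed

lemma op_sub_Union_op_span: "op_sub (insert X S) (\<Union>n. op_span X L n)"
proof (rule op_subI)
  fix x y assume "x \<in> (\<Union>n. op_span X L n)" "y \<in> (\<Union>n. op_span X L n)"
  then obtain m n where "x \<in> op_span X L m" "y \<in> op_span X L n" by blast
  then have "x \<in> op_span X L (max m n)" "y \<in> op_span X L (max m n)"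
    using op_span_mono by (meson monoD max.cobounded1 max.cobounded2 subsetD)+
  then show "x - y \<in> (\<Union>n. op_span X L n)" using op_subD(2)[OF op_sub_op_span] by blast
next
  fix Y x assume Y: "Y \<in> insert X S" and "x \<in> (\<Union>n. op_span X L n)"
  then obtain n where n: "x \<in> op_span X L n" by blast
  from Y show "Y x \<in> (\<Union>n. op_span X L n)"
  proof
    assume "Y = X"
    then show ?thesis using op_span_shift[OF n] by blast
  next
    assume "Y \<in> S"
    then show ?thesis using op_subD(3)[OF op_sub_op_span _ n] by blast
  qed
qed (use op_subD(1)[OF op_sub_op_span] in blast)

text \<open>Hilbert's basis theorem: an ascending chain is controlled by its modules of leading
  coefficients, which increase both along the chain and with the degree.\<close>

lemma acc_Union_op_span:
  assumes "acc S L"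
  shows "acc (insert X S) (\<Union>n. op_span X L n)"
  unfolding acc_def
proof (intro allI impI)
  fix U :: "nat \<Rightarrow> 'b set"
  assume U: "\<forall>k. op_sub (insert X S) (U k) \<and> U k \<subseteq> (\<Union>n. op_span X L n)" and mono: "mono U"
  note sub = op_subD[OF conjunct1[OF spec[OF U]]]
  define C where "C = (\<lambda>n k. {l \<in> L. \<exists>y\<in>op_span X L n. y + (X ^^ n) l \<in> U k})"
  have subC: "op_sub S (C n k)" for n k
  proof (rule op_subI)
    show "0 \<in> C n k"
      unfolding C_def using op_subD(1)[OF L] op_subD(1)[OF op_sub_op_span, of n] sub(1)[of k] additive.zero[OF additive_pow, of n]
      by (auto intro!: bexI[of _ 0])
    fix x y assume "x \<in> C n k" "y \<in> C n k"
    then obtain a b where *: "x \<in> L" "y \<in> L" "a \<in> op_span X L n" "b \<in> op_span X L n"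
       "a + (X ^^ n) x \<in> U k" "b + (X ^^ n) y \<in> U k" unfolding C_def by blast
    have "(a + (X ^^ n) x) - (b + (X ^^ n) y) \<in> U k" using sub(2) * by blast
    moreover have "(a + (X ^^ n) x) - (b + (X ^^ n) y) = (a - b) + (X ^^ n) (x - y)"
      by (simp add: additive.diff[OF additive_pow])
    ultimately show "x - y \<in> C n k" unfolding C_def
      using op_subD(2)[OF L *(1,2)] op_subD(2)[OF op_sub_op_span *(3,4)] by auto
  next
    fix Y x assume Y: "Y \<in> S" and "x \<in> C n k"
    then obtain a where *: "x \<in> L" "a \<in> op_span X L n" "a + (X ^^ n) x \<in> U k" unfolding C_def by blast
    have "Y (a + (X ^^ n) x) \<in> U k" using sub(3) Y * by blast
    then have "Y a + (X ^^ n) (Y x) \<in> U k" using Y by (simp add: additive.add[OF addS] comm_pow)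
    then show "Y x \<in> C n k" unfolding C_def
      using op_subD(3)[OF L Y *(1)] op_subD(3)[OF op_sub_op_span Y *(2)] by auto
  qed
  have CL: "C n k \<subseteq> L" for n k unfolding C_def by blast
  have C_k: "C n k \<subseteq> C n k'" if "k \<le> k'" for n k k'
    using monoD[OF mono that] unfolding C_def by blast
  have "C n k \<subseteq> C (Suc n) k" for n k
  proof
    fix l assume "l \<in> C n k"
    then obtain a where *: "l \<in> L" "a \<in> op_span X L n" "a + (X ^^ n) l \<in> U k" unfolding C_def by blast
    have "X (a + (X ^^ n) l) \<in> U k" using sub(3) * by blast
    then have "X a + (X ^^ Suc n) l \<in> U k" by (simp add: additive.add[OF addX])
    then show "l \<in> C (Suc n) k" unfolding C_def using op_span_shift[OF *(2)] *(1) by blast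
  qed
  then have C_n: "C n k \<subseteq> C n' k" if "n \<le> n'" for n n' k
    using that by (rule lift_Suc_mono_le)
  \<comment> \<open>The diagonal chain settles all degrees from \<open>k0\<close> on at once. The
    finitely many lower degrees are settled one by one, and \<open>T\<close> is the largest index
    required.\<close>
  have "mono (\<lambda>k. C k k)" using C_k C_n unfolding mono_def by blast
  then obtain k0 where k0: "\<And>k. k \<ge> k0 \<Longrightarrow> C k k = C k0 k0"
    using accD[OF assms, of "\<lambda>k. C k k"] subC CL by auto
  have "\<exists>t. \<forall>k\<ge>t. C n k = C n t" for n
    using accD[OF assms, of "\<lambda>k. C n k"] subC CL C_k unfolding mono_def by metis
  then obtain t where t: "\<And>n k. k \<ge> t n \<Longrightarrow> C n k = C n (t n)" by metis
  define T where "T = Max (insert k0 (t ` {..<k0}))"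
  have T: "T \<ge> k0" "\<And>n. n < k0 \<Longrightarrow> t n \<le> T" unfolding T_def by auto
  have stable: "C n k = C n T" if "k \<ge> T" for n k
  proof (cases "n < k0")
    case True
    then show ?thesis using t[of n k] t[of n T] T(2)[of n] that by auto
  next
    case False
    \<comment> \<open>Raising both indices lands in the stable diagonal value
      \<open>C k0 k0\<close>, which \<open>C n T\<close> already contains because \<open>n\<close>
      and \<open>T\<close> are at least \<open>k0\<close>.\<close>
    have "C n k \<subseteq> C (max n k) (max n k)" using C_k C_n by (meson max.cobounded1 max.cobounded2 order_trans)
    also have "\<dots> = C k0 k0" using k0[of "max n k"] False by auto
    also have "\<dots> \<subseteq> C n T" using C_k[OF T(1), of k0] C_n[of k0 n T] False by auto
    finally show ?thesis using C_k[OF that, of n] by blast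
  qed
  have "U k \<inter> op_span X L n \<subseteq> U T" if "k \<ge> T" for k n
  proof (induction n)
    case 0
    then show ?case using sub(1) by auto
  next
    case (Suc n)
    show ?case
    proof
      fix u assume u: "u \<in> U k \<inter> op_span X L (Suc n)"
      then obtain y l where yl: "u = y + (X ^^ n) l" "y \<in> op_span X L n" "l \<in> L" by auto
      then have "l \<in> C n k" using u unfolding C_def by blast
      then have "l \<in> C n T" using stable[OF that] by blast
      \<comment> \<open>Cancelling the top coefficient against an element of \<open>U T\<close>
        leaves an element of \<open>U k\<close> of lower degree.\<close>
      then obtain z where z: "z \<in> op_span X L n" "z + (X ^^ n) l \<in> U T" unfolding C_def by blast
      then have "z + (X ^^ n) l \<in> U k" using monoD[OF mono that] by blast
      then have "u - (z + (X ^^ n) l) \<in> U k" using sub(2) u by blast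
      then have "y - z \<in> U k \<inter> op_span X L n"
        using yl z op_subD(2)[OF op_sub_op_span] by auto
      then have "y - z \<in> U T" using Suc by blast
      from op_sub_add[OF conjunct1[OF spec[OF U]] this z(2)] show "u \<in> U T" by (simp add: yl)
    qed
  qed
  then have "U k \<subseteq> U T" if "k \<ge> T" for k
    using that U by blast
  then show "\<exists>t. \<forall>n\<ge>t. U n = U t" using mono by (metis antisym monoD)
qed

end

section \<open>Rees modules\<close>

lemma is_ideal_iff_op_sub: "is_ideal U \<longleftrightarrow> op_sub (range (*)) U"
proof
  assume U: "is_ideal U"
  then have "x - y \<in> U" if "x \<in> U" "y \<in> U" for x y
    using that unfolding is_ideal_def by (metis mult_minus1 diff_conv_add_uminus)
  then show "op_sub (range (*)) U" using U unfolding op_sub_def is_ideal_def by blast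
next
  assume "op_sub (range (*)) U"
  from op_subD(1,3)[OF this] op_sub_add[OF this] show "is_ideal U" unfolding is_ideal_def by auto
qed

lemma subset_ideal_gen: "S \<subseteq> ideal_gen S"
  unfolding ideal_gen_def by blast

lemma ideal_gen_least: "is_ideal J \<Longrightarrow> S \<subseteq> J \<Longrightarrow> ideal_gen S \<subseteq> J"
  unfolding ideal_gen_def by blast

lemma finite_subset_chain:
  fixes U :: "nat \<Rightarrow> 'a set"
  assumes "finite F" "mono U" "F \<subseteq> (\<Union>n. U n)"
  shows "\<exists>t. F \<subseteq> U t"
  using assms
proof (induction F)
  case (insert x F)
  then obtain s t where "x \<in> U s" "F \<subseteq> U t" by auto
  then have "insert x F \<subseteq> U (max s t)"
    using monoD[OF insert.prems(1), of s "max s t"] monoD[OF insert.prems(1), of t "max s t"] by auto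
  then show ?case ..
qed auto

lemma acc_ring:
  assumes "noetherian_ring TYPE('a::comm_ring_1)"
  shows "acc (range (*)) (UNIV :: 'a set)"
  unfolding acc_def
proof (intro allI impI)
  fix U :: "nat \<Rightarrow> 'a set"
  assume "\<forall>n. op_sub (range (*)) (U n) \<and> U n \<subseteq> UNIV" and mono: "mono U"
  then have U: "is_ideal (U n)" for n by (simp add: is_ideal_iff_op_sub)
  have "is_ideal (\<Union>n. U n)"
    unfolding is_ideal_def
  proof (intro conjI ballI allI)
    fix a b assume "a \<in> (\<Union>n. U n)" "b \<in> (\<Union>n. U n)"
    then obtain m n where "a \<in> U m" "b \<in> U n" by blast
    then have "a \<in> U (max m n)" "b \<in> U (max m n)"
      using monoD[OF mono, of m "max m n"] monoD[OF mono, of n "max m n"] by auto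
    then have "a + b \<in> U (max m n)" using U[of "max m n"] unfolding is_ideal_def by blast
    then show "a + b \<in> (\<Union>n. U n)" by blast
  next
    fix r a assume "a \<in> (\<Union>n. U n)"
    then obtain n where "a \<in> U n" by blast
    then have "r * a \<in> U n" using U[of n] unfolding is_ideal_def by blast
    then show "r * a \<in> (\<Union>n. U n)" by blast
  qed (use U[of 0] in \<open>auto simp: is_ideal_def\<close>)
  with assms[unfolded noetherian_ring_def, rule_format]
  obtain F where F: "finite F" "(\<Union>n. U n) = ideal_gen F" by metis
  then obtain t where "F \<subseteq> U t"
    using finite_subset_chain[OF F(1) mono] subset_ideal_gen[of F] by auto
  then have "(\<Union>n. U n) \<subseteq> U t" using F(2) ideal_gen_least[OF U] by simp
  then show "\<exists>t. \<forall>n\<ge>t. U n = U t" using mono unfolding mono_def by blast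
qed

text \<open>Serves twice: for ideals, to find maximal members, and for saturated graded families, as
  the ground of a Noetherian induction.\<close>

lemma wf_if_chains_stabilize:
  fixes P :: "'c::order \<Rightarrow> bool"
  assumes "\<And>f. (\<And>n::nat. P (f n)) \<Longrightarrow> mono f \<Longrightarrow> \<exists>t. \<forall>n\<ge>t. f n = f t"
  shows "wf {(y, x). P x \<and> P y \<and> x < y}"
  unfolding wf_iff_no_infinite_down_chain
proof
  assume "\<exists>f. \<forall>i. (f (Suc i), f i) \<in> {(y, x). P x \<and> P y \<and> x < y}"
  then obtain f :: "nat \<Rightarrow> 'c" where f: "\<And>i. P (f i)" "\<And>i. f i < f (Suc i)" by blast
  then have "mono f" by (simp add: mono_iff_le_Suc less_imp_le)
  with assms[of f] f(1) obtain t where "\<forall>n\<ge>t. f n = f t" by blast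
  then have "f (Suc t) = f t" using le_SucI[OF order_refl, of t] by blast
  then show False using f(2)[of t] by simp
qed

lemma wf_ideals:
  assumes "noetherian_ring TYPE('a::comm_ring_1)"
  shows "wf {(K, J :: 'a set). is_ideal J \<and> is_ideal K \<and> J \<subset> K}"
  by (rule wf_if_chains_stabilize[where P = is_ideal])
    (use acc_ring[OF assms] in \<open>auto simp: acc_def is_ideal_iff_op_sub\<close>)

text \<open>Maximality is relative to \<J>. The families that occur are annihilators, ideals without
  1, and proper subideals of a given ideal.\<close>

lemma maximal_ideal_exists:
  assumes "noetherian_ring TYPE('a::comm_ring_1)" and "J \<in> \<J>" and "\<And>J. J \<in> \<J> \<Longrightarrow> is_ideal (J :: 'a set)"
  obtains K where "K \<in> \<J>" "J \<subseteq> K" "\<And>K'. K' \<in> \<J> \<Longrightarrow> K \<subseteq> K' \<Longrightarrow> K' = K"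
proof -
  have "J \<in> {K \<in> \<J>. J \<subseteq> K}" using assms(2) by simp
  then obtain K where K: "K \<in> {K \<in> \<J>. J \<subseteq> K}"
    "\<And>K'. (K', K) \<in> {(K, J :: 'a set). is_ideal J \<and> is_ideal K \<and> J \<subset> K} \<Longrightarrow> K' \<notin> {K \<in> \<J>. J \<subseteq> K}"
    by (rule wfE_min[OF wf_ideals[OF assms(1)]]) auto
  have "K' = K" if K': "K' \<in> \<J>" "K \<subseteq> K'" for K'
    using K(2)[of K'] K(1) K' assms(3)[of K] assms(3)[of K'] by auto
  then show thesis using that[of K] K(1) by blast
qed

text \<open>A sequence stands for a series in a Rees variable \<open>T\<close>, and this operator is
  multiplication by \<open>a T\<close>. With the coefficientwise scalars of \<open>pw_scale\<close>
  and \<open>a\<close> running through generators of \<open>I\<close>, these operators generate the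
  action of the Rees algebra.\<close>

definition shift_scale :: "('a \<Rightarrow> 'b \<Rightarrow> 'b) \<Rightarrow> 'a \<Rightarrow> (nat \<Rightarrow> 'b) \<Rightarrow> nat \<Rightarrow> 'b::ab_group_add" where
  "shift_scale scale a f n = (case n of 0 \<Rightarrow> 0 | Suc k \<Rightarrow> scale a (f k))"

lemma shift_scale_simps [simp]:
  "shift_scale scale a f 0 = 0" "shift_scale scale a f (Suc k) = scale a (f k)"
  by (simp_all add: shift_scale_def)

abbreviation pw_scale :: "('a \<Rightarrow> 'b \<Rightarrow> 'b) \<Rightarrow> ((nat \<Rightarrow> 'b) \<Rightarrow> nat \<Rightarrow> 'b) set" where
  "pw_scale scale \<equiv> range (\<lambda>r f n. scale r (f n))"

definition single :: "nat \<Rightarrow> 'b \<Rightarrow> nat \<Rightarrow> 'b::ab_group_add" where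
  "single n v i = (if i = n then v else 0)"

context module
begin

lemma subspace_iff_op_sub: "subspace U \<longleftrightarrow> op_sub (range scale) U"
proof
  assume U: "op_sub (range scale) U"
  show "subspace U"
    by (rule subspaceI) (use op_subD(1)[OF U] op_sub_add[OF U] op_subD(3)[OF U rangeI] in auto)
qed (simp add: op_sub_def subspace_0 subspace_diff subspace_scale)

lemma additive_scale: "additive (scale r)"
  by (simp add: additive_def scale_right_distrib)

lemma acc_span:
  assumes "noetherian_ring TYPE('a)" "finite F"
  shows "acc (range scale) (span F)"
  using assms(2)
proof (induction F)
  case empty
  have "U n = U 0" if "\<forall>n. op_sub (range scale) (U n) \<and> U n \<subseteq> {0}" for U :: "nat \<Rightarrow> 'b set" and n
    using that op_subD(1)[of "range scale" "U n"] op_subD(1)[of "range scale" "U 0"] by blast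
  then show ?case unfolding acc_def span_empty by blast
next
  case (insert v F)
  have "acc (range scale) ((\<lambda>r. scale r v) ` UNIV)"
    by (rule acc_image[OF acc_ring[OF assms(1)]])
      (simp add: op_sub_def, simp add: additive_def scale_left_distrib, force)
  then have "acc (range scale) {a + b | a b. a \<in> span {v} \<and> b \<in> span F}"
    unfolding span_singleton[symmetric]
    by (rule acc_add[OF _ insert.IH])
      (auto simp: subspace_iff_op_sub[symmetric] additive_scale simp del: span_insert)
  then show ?case using span_Un[of "{v}" F] by simp
qed

lemma ideal_smult_subspace: "subspace (ideal_smult scale J L)"
  unfolding ideal_smult_def by simp

lemma ideal_smultI: "r \<in> J \<Longrightarrow> u \<in> L \<Longrightarrow> scale r u \<in> ideal_smult scale J L"
  unfolding ideal_smult_def by (auto intro: span_base)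

lemma ideal_smult_least:
  "subspace T \<Longrightarrow> (\<And>r u. r \<in> J \<Longrightarrow> u \<in> L \<Longrightarrow> scale r u \<in> T) \<Longrightarrow> ideal_smult scale J L \<subseteq> T"
  unfolding ideal_smult_def by (rule span_minimal) auto

lemma subspace_scalars_into: "subspace T \<Longrightarrow> is_ideal {r. scale r u \<in> T}"
  unfolding is_ideal_def
  by (simp add: subspace_0 scale_left_distrib subspace_add) (metis scale_scale subspace_scale)

lemma subspace_vimage_scale: "subspace T \<Longrightarrow> subspace {u. scale r u \<in> T}"
  unfolding subspace_def by (simp add: scale_right_distrib scale_left_commute[of r] del: scale_scale)

end

section \<open>The adic filtration and chain conditions for graded families\<close>

locale ideal_module = module scale
  for scale :: "'a::comm_ring_1 \<Rightarrow> 'b::ab_group_add \<Rightarrow> 'b" (infixr "*s" 75) +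
  fixes I :: "'a set"
  assumes noeth: "noetherian_ring TYPE('a)" and ideal: "is_ideal I"
begin

text \<open>This is \<open>I^n M\<close>, one factor of \<open>I\<close> at a time to suit
  inductions; \<open>adic_eq\<close> compares it with \<open>ideal_pow\<close>.\<close>

primrec adic :: "'b set \<Rightarrow> nat \<Rightarrow> 'b set" where
  "adic M 0 = M"
| "adic M (Suc n) = ideal_smult scale I (adic M n)"

text \<open>The condition for the direct sum of the \<open>E n\<close> to be a homogeneous submodule
  over the Rees algebra of \<open>I\<close>.\<close>

definition graded :: "(nat \<Rightarrow> 'b set) \<Rightarrow> bool" where
  "graded E \<longleftrightarrow> (\<forall>n. subspace (E n)) \<and> (\<forall>n. \<forall>a\<in>I. \<forall>v\<in>E n. a *s v \<in> E (Suc n))"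

lemma gradedD:
  assumes "graded E"
  shows "subspace (E n)" "a \<in> I \<Longrightarrow> v \<in> E n \<Longrightarrow> a *s v \<in> E (Suc n)"
  using assms unfolding graded_def by auto

lemma adic_subspace: "subspace M \<Longrightarrow> subspace (adic M n)"
  by (cases n) (auto simp: ideal_smult_subspace)

lemma graded_adic: "subspace M \<Longrightarrow> graded (adic M)"
  unfolding graded_def by (auto simp: adic_subspace ideal_smultI)

lemma adic_Suc_subset: "subspace M \<Longrightarrow> adic M (Suc n) \<subseteq> adic M n"
  using ideal_smult_least[OF adic_subspace subspace_scale[OF adic_subspace]] by simp

lemma adic_antimono: "subspace M \<Longrightarrow> m \<le> n \<Longrightarrow> adic M n \<subseteq> adic M m"
  by (rule lift_Suc_antimono_le[of "adic M"]) (simp_all only: adic_Suc_subset)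

lemma adic_subset: "subspace M \<Longrightarrow> adic M n \<subseteq> M"
  using adic_antimono[of M 0 n] by simp

text \<open>Starting from \<open>M\<close> placed in degree 0, the operators \<open>a T\<close> are
  adjoined one at a time by Hilbert's basis theorem. The resulting \<open>L\<close> is stable and
  contains degree 0, hence all of the Rees module of \<open>M\<close>.\<close>

lemma acc_rees_module:
  assumes M: "acc (range scale) M" "subspace M" and A: "finite A"
  shows "\<exists>L. acc (pw_scale scale \<union> shift_scale scale ` A) L \<and>
    op_sub (pw_scale scale \<union> shift_scale scale ` A) L \<and> single 0 ` M \<subseteq> L"
  using A
proof (induction A)
  case empty
  have "acc (pw_scale scale) (single 0 ` M)"
    by (rule acc_image[OF M(1)])
      (use M(2) in \<open>auto simp: subspace_iff_op_sub additive_def single_def fun_eq_iff\<close>)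
  moreover have "op_sub (pw_scale scale) (single 0 ` M)"
  proof (rule op_subI)
    show "0 \<in> single 0 ` M" using subspace_0[OF M(2)] by (force simp: single_def fun_eq_iff)
    fix x y :: "nat \<Rightarrow> 'b" assume "x \<in> single 0 ` M" "y \<in> single 0 ` M"
    then obtain v w where *: "x = single 0 v" "y = single 0 w" "v \<in> M" "w \<in> M" by blast
    then have "x - y = single 0 (v - w)" by (auto simp: single_def fun_eq_iff)
    then show "x - y \<in> single 0 ` M" using * subspace_diff[OF M(2)] by blast
  next
    fix X and x :: "nat \<Rightarrow> 'b" assume "X \<in> pw_scale scale" "x \<in> single 0 ` M"
    then obtain r v where *: "X = (\<lambda>f n. r *s f n)" "x = single 0 v" "v \<in> M" by blast
    then have "X x = single 0 (r *s v)" by (auto simp: single_def fun_eq_iff)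
    then show "X x \<in> single 0 ` M" using * subspace_scale[OF M(2)] by blast
  qed
  ultimately show ?case by auto
next
  case (insert a A)
  let ?S = "pw_scale scale \<union> shift_scale scale ` A" and ?X = "shift_scale scale a"
  obtain L where L: "acc ?S L" "op_sub ?S L" "single 0 ` M \<subseteq> L" using insert.IH by blast
  have addX: "additive (shift_scale scale b)" for b
    by (auto simp: additive_def fun_eq_iff shift_scale_def scale_right_distrib split: nat.split)
  have addS: "additive Y" if "Y \<in> ?S" for Y
    using that addX by (auto simp: additive_def fun_eq_iff scale_right_distrib)
  have comm: "Y (?X u) = ?X (Y u)" if "Y \<in> ?S" for Y u
    using that by (auto simp: fun_eq_iff shift_scale_def mult.commute split: nat.split)
  let ?L = "\<Union>n. op_span ?X L n"
  have eq: "insert ?X ?S = pw_scale scale \<union> shift_scale scale ` insert a A" by auto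
  have "acc (insert ?X ?S) ?L"
    by (rule acc_Union_op_span[OF L(2) addX addS comm L(1)])
  moreover have "op_sub (insert ?X ?S) ?L"
    by (rule op_sub_Union_op_span[OF L(2) addX addS comm])
  moreover have "single 0 ` M \<subseteq> ?L"
    using subset_op_span[OF L(2) addX addS comm] L(3) by blast
  ultimately show ?case unfolding eq by blast
qed

text \<open>Each \<open>E k\<close> cuts a stable subgroup out of the Noetherian \<open>L\<close>,
  and it can be read back from the one-term sequences it contains.\<close>

lemma graded_chain_stabilizes:
  fixes E :: "nat \<Rightarrow> nat \<Rightarrow> 'b set"
  assumes M: "acc (range scale) M" "subspace M"
    and E: "\<And>k. graded (E k)" "\<And>k n. E k n \<subseteq> adic M n" "mono E"
  shows "\<exists>t. \<forall>k\<ge>t. E k = E t"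
proof -
  obtain A where A: "finite A" "I = ideal_gen A"
    using noeth ideal unfolding noetherian_ring_def by blast
  let ?S = "pw_scale scale \<union> shift_scale scale ` A"
  obtain L where L: "acc ?S L" "op_sub ?S L" "single 0 ` M \<subseteq> L"
    using acc_rees_module[OF M A(1)] by blast
  have "op_sub (range scale) {v. single n v \<in> L}" for n
  proof (rule op_subI)
    have "single n 0 = (0 :: nat \<Rightarrow> 'b)" by (simp add: single_def fun_eq_iff)
    then show "0 \<in> {v. single n v \<in> L}" using op_subD(1)[OF L(2)] by simp
    fix x y assume "x \<in> {v. single n v \<in> L}" "y \<in> {v. single n v \<in> L}"
    moreover have "single n (x - y) = single n x - single n y" by (auto simp: single_def fun_eq_iff)
    ultimately show "x - y \<in> {v. single n v \<in> L}" using op_subD(2)[OF L(2)] by simp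
  next
    fix X x assume "X \<in> range scale" and x: "x \<in> {v. single n v \<in> L}"
    then obtain r where r: "X = scale r" by blast
    have "(\<lambda>i. r *s single n x i) \<in> L" by (rule op_subD(3)[OF L(2)]) (use x in auto)
    moreover have "(\<lambda>i. r *s single n x i) = single n (r *s x)" by (auto simp: single_def fun_eq_iff)
    ultimately show "X x \<in> {v. single n v \<in> L}" using r by simp
  qed
  then have sub: "subspace {v. single n v \<in> L}" for n by (simp add: subspace_iff_op_sub)
  have "adic M n \<subseteq> {v. single n v \<in> L}" for n
  proof (induction n)
    case 0
    then show ?case using L(3) by auto
  next
    case (Suc n)
    have "r *s u \<in> {v. single (Suc n) v \<in> L}" if "r \<in> I" "u \<in> adic M n" for r u
    proof -
      \<comment> \<open>The scalars that carry \<open>u\<close> into degree \<open>n + 1\<close> of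
        \<open>L\<close> form an ideal, so checking the generators \<open>A\<close> of
        \<open>I\<close> suffices.\<close>
      have "A \<subseteq> {r. r *s u \<in> {v. single (Suc n) v \<in> L}}"
      proof
        fix a assume "a \<in> A"
        then have "shift_scale scale a (single n u) \<in> L"
          using op_subD(3)[OF L(2)] Suc that(2) by blast
        moreover have "shift_scale scale a (single n u) = single (Suc n) (a *s u)"
          by (auto simp: fun_eq_iff single_def shift_scale_def split: nat.split)
        ultimately show "a \<in> {r. r *s u \<in> {v. single (Suc n) v \<in> L}}" by simp
      qed
      then have "I \<subseteq> {r. r *s u \<in> {v. single (Suc n) v \<in> L}}"
        unfolding A(2) by (rule ideal_gen_least[OF subspace_scalars_into[OF sub]])
      then show ?thesis using that by blast
    qed
    then show ?case unfolding adic.simps by (rule ideal_smult_least[OF sub])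
  qed
  then have single_in: "single n v \<in> L" if "v \<in> adic M n" for n v using that by blast
  \<comment> \<open>Gradedness of \<open>E k\<close> is what makes this set stable under the
    shifts.\<close>
  define U where "U = (\<lambda>k. {f \<in> L. \<forall>n. f n \<in> E k n})"
  have "op_sub ?S (U k)" for k
  proof (rule op_subI)
    show "0 \<in> U k" unfolding U_def using op_subD(1)[OF L(2)] gradedD(1)[OF E(1)] subspace_0 by auto
    show "x - y \<in> U k" if "x \<in> U k" "y \<in> U k" for x y
      using that op_subD(2)[OF L(2)] gradedD(1)[OF E(1)] subspace_diff unfolding U_def by auto
  next
    fix X x assume X: "X \<in> ?S" and x: "x \<in> U k"
    have "X x \<in> L" using op_subD(3)[OF L(2) X] x unfolding U_def by blast
    moreover have "X x n \<in> E k n" for n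
      using X
    proof
      assume "X \<in> pw_scale scale"
      then show ?thesis using x gradedD(1)[OF E(1)] subspace_scale unfolding U_def by auto
    next
      assume "X \<in> shift_scale scale ` A"
      then obtain a where "X = shift_scale scale a" "a \<in> I" using A subset_ideal_gen by blast
      then show ?thesis
        using x gradedD[OF E(1)] subspace_0 unfolding U_def by (cases n) auto
    qed
    ultimately show "X x \<in> U k" unfolding U_def by blast
  qed
  moreover have "mono U" unfolding U_def
    using E(3) unfolding mono_def le_fun_def by blast
  moreover have "U k \<subseteq> L" for k unfolding U_def by blast
  ultimately obtain t where t: "\<And>k. k \<ge> t \<Longrightarrow> U k = U t"
    using accD[OF L(1), of U] by metis
  have "E k n \<subseteq> E t n" if "k \<ge> t" for k n
  proof
    fix v assume v: "v \<in> E k n"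
    have "single n v \<in> U k"
      using single_in[of v n] E(2) v subspace_0[OF gradedD(1)[OF E(1)]] by (auto simp: U_def single_def)
    then have "single n v \<in> U t" using t[OF that] by simp
    then have "single n v n \<in> E t n" unfolding U_def by blast
    then show "v \<in> E t n" by (simp add: single_def)
  qed
  then have "E k = E t" if "k \<ge> t" for k
    using that monoD[OF E(3) that] by (auto simp: le_fun_def fun_eq_iff)
  then show ?thesis by blast
qed

end

section \<open>General elements avoid finitely many ideals\<close>

context ideal_module
begin

text \<open>The inductive form of: for some \<open>p\<close>, all products of \<open>p\<close>
  elements of \<open>I\<close> carry \<open>v\<close> into \<open>E (n + p)\<close>. The depth may
  differ between branches, so no exponent has to be tracked.\<close>

inductive sat :: "(nat \<Rightarrow> 'b set) \<Rightarrow> nat \<Rightarrow> 'b \<Rightarrow> bool" for E where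
  base: "v \<in> E n \<Longrightarrow> sat E n v"
| step: "(\<And>a. a \<in> I \<Longrightarrow> sat E (Suc n) (a *s v)) \<Longrightarrow> sat E n v"

lemma sat_ideal:
  assumes "graded E" "sat E n v" "a \<in> I"
  shows "sat E (Suc n) (a *s v)"
  using assms(2)
proof cases
  case base
  show ?thesis by (rule sat.base, rule gradedD(2)[OF assms(1,3) base])
next
  case step
  show ?thesis by (rule step[OF assms(3)])
qed

lemma sat_scale:
  assumes E: "graded E"
  shows "sat E n v \<Longrightarrow> sat E n (r *s v)"
proof (induction rule: sat.induct)
  case (base v n)
  show ?case by (rule sat.base, rule subspace_scale[OF gradedD(1)[OF E] base])
next
  case (step n v)
  then show ?case using sat.step[of E n "r *s v"] by (simp add: mult.commute)
qed

text \<open>The two derivations may have different depths. Once one summand has reached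
  \<open>E\<close>, gradedness keeps it there while the other continues.\<close>

lemma sat_add:
  assumes E: "graded E"
  shows "sat E n v \<Longrightarrow> sat E n w \<Longrightarrow> sat E n (v + w)"
proof (induction arbitrary: w rule: sat.induct)
  case v: (base v n)
  from v(2,1) show ?case
  proof (induction arbitrary: v rule: sat.induct)
    case (base w n)
    show ?case by (rule sat.base, rule subspace_add[OF gradedD(1)[OF E] base(2,1)])
  next
    case (step n w)
    show ?case
      by (rule sat.step) (simp add: scale_right_distrib step.IH gradedD(2)[OF E _ step.prems])
  qed
next
  case (step n v)
  show ?case
    by (rule sat.step) (simp add: scale_right_distrib step.IH sat_ideal[OF E step.prems])
qed

definition saturation :: "(nat \<Rightarrow> 'b set) \<Rightarrow> (nat \<Rightarrow> 'b set) \<Rightarrow> nat \<Rightarrow> 'b set" where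
  "saturation G E n = {v \<in> G n. sat E n v}"

text \<open>In terms of the quotient of \<open>G\<close> by \<open>E\<close>: no nonzero homogeneous
  element is killed by the degree one part of the Rees algebra.\<close>

definition saturated :: "(nat \<Rightarrow> 'b set) \<Rightarrow> (nat \<Rightarrow> 'b set) \<Rightarrow> bool" where
  "saturated G E \<longleftrightarrow> graded E \<and> (\<forall>n. E n \<subseteq> G n) \<and>
     (\<forall>n. \<forall>v\<in>G n. (\<forall>a\<in>I. a *s v \<in> E (Suc n)) \<longrightarrow> v \<in> E n)"

lemma saturatedD:
  assumes "saturated G E"
  shows "graded E" "v \<in> E n \<Longrightarrow> v \<in> G n"
    "v \<in> G n \<Longrightarrow> (\<And>a. a \<in> I \<Longrightarrow> a *s v \<in> E (Suc n)) \<Longrightarrow> v \<in> E n"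
  using assms unfolding saturated_def by auto

lemma saturated_saturation:
  assumes "graded G" "graded E"
  shows "saturated G (saturation G E)"
  unfolding saturated_def
proof (intro conjI allI ballI impI)
  show "graded (saturation G E)"
    unfolding graded_def saturation_def
    using gradedD[OF assms(1)] sat_ideal[OF assms(2)] sat_scale[OF assms(2)] sat_add[OF assms(2)]
      sat.base[of 0 E, OF subspace_0[OF gradedD(1)[OF assms(2)]]]
    by (simp add: subspace_def)
  fix n v assume "v \<in> G n" "\<forall>a\<in>I. a *s v \<in> saturation G E (Suc n)"
  then show "v \<in> saturation G E n"
    using sat.step[of E n v] unfolding saturation_def by blast
qed (auto simp: saturation_def)

text \<open>Replaces the choice of \<open>x\<close> outside the associated primes of the associated graded
  module: each \<open>V\<close> is the degree one part of such a prime, obtained as a maximal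
  degree one annihilator.\<close>

lemma finite_exceptional_ideals:
  assumes M: "acc (range scale) M" "subspace M" and "saturated (adic M) E"
  shows "\<exists>\<V>. finite \<V> \<and> (\<forall>V\<in>\<V>. is_ideal V \<and> V \<subset> I) \<and>
    (\<forall>x\<in>I - \<Union>\<V>. \<forall>n. \<forall>v\<in>adic M n. x *s v \<in> E (Suc n) \<longrightarrow> v \<in> E n)"
proof -
  define G where "G = adic M"
  have G: "graded G" unfolding G_def by (rule graded_adic[OF M(2)])
  have "\<exists>t. \<forall>n\<ge>t. f n = f t" if f: "\<And>n. saturated G (f n)" "mono f" for f :: "nat \<Rightarrow> nat \<Rightarrow> 'b set"
    by (rule graded_chain_stabilizes[OF M _ _ f(2)]) (use saturatedD(1,2)[OF f(1)] in \<open>auto simp: G_def\<close>)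
  \<comment> \<open>The induction runs from larger to smaller saturated families.\<close>
  then have wf: "wf {(E', E). saturated G E \<and> saturated G E' \<and> E < E'}"
    by (rule wf_if_chains_stabilize)
  have "saturated G E \<Longrightarrow> \<exists>\<V>. finite \<V> \<and> (\<forall>V\<in>\<V>. is_ideal V \<and> V \<subset> I) \<and>
    (\<forall>x\<in>I - \<Union>\<V>. \<forall>n. \<forall>v\<in>G n. x *s v \<in> E (Suc n) \<longrightarrow> v \<in> E n)"
  proof (induction E rule: wf_induct_rule[OF wf])
    case (1 E)
    note E = saturatedD[OF \<open>saturated G E\<close>]
    note subE = gradedD(1)[OF E(1)]
    show ?case
    proof (cases "\<forall>n. G n \<subseteq> E n")
      case True
      then show ?thesis by (intro exI[of _ "{}"]) auto
    next
      case False
      define ann where "ann n v = {x \<in> I. x *s v \<in> E (Suc n)}" for n v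
      define \<J> where "\<J> = {ann n v | n v. v \<in> G n \<and> v \<notin> E n}"
      have ann: "is_ideal (ann n v)" for n v
        using subspace_scalars_into[OF subE[of "Suc n"], of v] ideal
        unfolding ann_def is_ideal_def by simp
      from False obtain J where "J \<in> \<J>" unfolding \<J>_def by blast
      moreover have "is_ideal J" if "J \<in> \<J>" for J using that ann unfolding \<J>_def by blast
      ultimately obtain V where V: "V \<in> \<J>" "\<And>V'. V' \<in> \<J> \<Longrightarrow> V \<subseteq> V' \<Longrightarrow> V' = V"
        using maximal_ideal_exists[OF noeth, of J \<J>] by metis
      then obtain j v where v: "V = ann j v" "v \<in> G j" "v \<notin> E j" unfolding \<J>_def by blast
      \<comment> \<open>If \<open>V\<close> were all of \<open>I\<close>, saturatedness would put
        \<open>v\<close> into \<open>E j\<close>.\<close>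
      have "V \<noteq> I" using E(3)[OF v(2)] v(1,3) unfolding ann_def by blast
      then have VI: "V \<subset> I" unfolding v(1) ann_def by blast
      \<comment> \<open>\<open>Z d\<close> replaces the power \<open>I^d\<close> and has all that is
        required: it is an ideal, \<open>I\<close> moves it into \<open>Z (Suc d)\<close>, its
        elements raise degrees in \<open>G\<close> and \<open>E\<close> by \<open>d\<close>, and 1
        lies in \<open>Z 0\<close>. As \<open>v\<close> lives in degree \<open>j\<close>, its
        coefficients \<open>D\<close> are shifted by \<open>j\<close> and zero below.\<close>
      define Z where "Z = (\<lambda>d. {c. \<forall>n. (\<forall>w\<in>G n. c *s w \<in> G (d + n)) \<and> (\<forall>w\<in>E n. c *s w \<in> E (d + n))})"
      define D where "D = (\<lambda>i. {c. c = 0 \<or> j \<le> i \<and> c \<in> Z (i - j)})"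
      have Z: "is_ideal (Z d)" for d
        unfolding is_ideal_def Z_def
        using subspace_0[OF gradedD(1)[OF G]] subspace_add[OF gradedD(1)[OF G]] subspace_scale[OF gradedD(1)[OF G]]
          subspace_0[OF subE] subspace_add[OF subE] subspace_scale[OF subE]
        by (simp add: scale_left_distrib flip: scale_scale)
      have D: "is_ideal (D i)" for i
        using Z[of "i - j"] unfolding D_def is_ideal_def by auto
      have ZI: "a * c \<in> Z (Suc d)" if "a \<in> I" "c \<in> Z d" for a c d
        using that gradedD(2)[OF G] gradedD(2)[OF E(1)] unfolding Z_def by (simp flip: scale_scale)
      have DI: "a * c \<in> D (Suc i)" if "a \<in> I" "c \<in> D i" for a c i
        using that ZI[of a c "i - j"] unfolding D_def by (auto simp: Suc_diff_le)
      have D1: "1 \<in> D j" unfolding D_def Z_def by simp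
      \<comment> \<open>The family generated by \<open>E\<close> and \<open>v\<close>. Its
        saturation contains \<open>v\<close> in degree \<open>j\<close>, so it is strictly larger
        than \<open>E\<close> and the induction hypothesis applies to it.\<close>
      define F where "F = (\<lambda>i. {e + c *s v | e c. e \<in> E i \<and> c \<in> D i})"
      have EF: "E i \<subseteq> F i" for i
        using D[of i] unfolding F_def is_ideal_def by (force intro: exI[of _ 0])
      have "graded F"
        unfolding graded_def
      proof (intro conjI allI ballI subspaceI)
        show "0 \<in> F n" for n using EF subspace_0[OF subE] by blast
        show "x + y \<in> F n" if xy: "x \<in> F n" "y \<in> F n" for n x y
        proof -
          obtain e c e' c' where *: "x = e + c *s v" "y = e' + c' *s v" "e \<in> E n" "e' \<in> E n" "c \<in> D n" "c' \<in> D n"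
            using xy unfolding F_def by blast
          have "x + y = (e + e') + (c + c') *s v" using * by (simp add: scale_left_distrib)
          moreover have "e + e' \<in> E n" using * subspace_add[OF subE] by blast
          moreover have "c + c' \<in> D n" using * D[of n] unfolding is_ideal_def by blast
          ultimately show ?thesis unfolding F_def by blast
        qed
        show "r *s x \<in> F n" if x: "x \<in> F n" for n r x
        proof -
          obtain e c where *: "x = e + c *s v" "e \<in> E n" "c \<in> D n"
            using x unfolding F_def by blast
          have "r *s x = r *s e + (r * c) *s v" using * by (simp add: scale_right_distrib)
          moreover have "r *s e \<in> E n" using * subspace_scale[OF subE] by blast
          moreover have "r * c \<in> D n" using * D[of n] unfolding is_ideal_def by blast
          ultimately show ?thesis unfolding F_def by blast
        qed
        show "a *s x \<in> F (Suc n)" if a: "a \<in> I" and x: "x \<in> F n" for n a x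
        proof -
          obtain e c where *: "x = e + c *s v" "e \<in> E n" "c \<in> D n"
            using x unfolding F_def by blast
          have "a *s x = a *s e + (a * c) *s v" using * by (simp add: scale_right_distrib)
          moreover have "a *s e \<in> E (Suc n)" using * gradedD(2)[OF E(1) a] by blast
          moreover have "a * c \<in> D (Suc n)" using DI a * by blast
          ultimately show ?thesis unfolding F_def by blast
        qed
      qed
      then have satF: "saturated G (saturation G F)" by (rule saturated_saturation[OF G])
      have "E \<le> saturation G F"
        unfolding le_fun_def saturation_def using EF E(2) sat.base by blast
      moreover have "v = 0 + 1 *s v" by simp
      then have "v \<in> F j" unfolding F_def using D1 subspace_0[OF subE] by blast
      then have "v \<in> saturation G F j" unfolding saturation_def using v(2) sat.base by blast
      ultimately have less: "E < saturation G F" using v(3) by (metis less_le)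
      from less satF \<open>saturated G E\<close> have "(saturation G F, E) \<in> {(E', E). saturated G E \<and> saturated G E' \<and> E < E'}" by simp
      from 1(1)[OF this satF]
      obtain \<V> where \<V>: "finite \<V>" "\<forall>V\<in>\<V>. is_ideal V \<and> V \<subset> I"
        "\<forall>x\<in>I - \<Union>\<V>. \<forall>n. \<forall>w\<in>G n. x *s w \<in> saturation G F (Suc n) \<longrightarrow> w \<in> saturation G F n"
        by meson
      have "w \<in> E n" if x: "x \<in> I - \<Union>(insert V \<V>)" and w: "w \<in> G n" "x *s w \<in> E (Suc n)" for x n w
      proof -
        have "x *s w \<in> saturation G F (Suc n)" using \<open>E \<le> saturation G F\<close> w(2) by (auto simp: le_fun_def)
        then have "sat F n w" using \<V>(3) x w(1) unfolding saturation_def by blast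
        then show ?thesis
          using w
        proof (induction rule: sat.induct)
          case (base w n)
          then obtain e c where *: "w = e + c *s v" "e \<in> E n" "c \<in> D n" unfolding F_def by blast
          have "c *s v \<in> E n"
          proof (rule ccontr)
            \<comment> \<open>The annihilator of \<open>c *s v\<close> modulo \<open>E\<close>
              contains \<open>V\<close>, hence equals \<open>V\<close> by maximality. But
              \<open>x\<close> belongs to it, because \<open>x *s w\<close> and
              \<open>x *s e\<close> lie in \<open>E\<close>, while \<open>x\<close> avoids
              \<open>V\<close>.\<close>
            assume c: "c *s v \<notin> E n"
            then have "j \<le> n" "c \<in> Z (n - j)" using *(3) subspace_0[OF subE] unfolding D_def by auto
            then have "c *s v \<in> G n" using v(2) unfolding Z_def by fastforce
            then have "ann n (c *s v) \<in> \<J>" using c unfolding \<J>_def by blast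
            moreover have "V \<subseteq> ann n (c *s v)"
            proof
              fix y assume "y \<in> V"
              then have "y \<in> I" "y *s v \<in> E (Suc j)" unfolding v(1) ann_def by auto
              show "y \<in> ann n (c *s v)"
                using \<open>c \<in> Z (n - j)\<close> \<open>j \<le> n\<close> \<open>y \<in> I\<close> \<open>y *s v \<in> E (Suc j)\<close>
                unfolding Z_def ann_def by (fastforce simp: mult.commute)
            qed
            ultimately have "ann n (c *s v) = V" using V(2) by blast
            moreover have "x *s (c *s v) \<in> E (Suc n)"
            proof -
              have "x *s (c *s v) = x *s w - x *s e" using * by (simp add: scale_right_distrib)
              then show ?thesis
                using base.prems(2) subspace_diff[OF subE] gradedD(2)[OF E(1)] *(2) x by simp
            qed
            ultimately show False using x unfolding ann_def by blast
          qed
          then show ?case using * subspace_add[OF subE] by blast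
        next
          case (step n w)
          \<comment> \<open>The assumptions on \<open>w\<close> pass to every \<open>a *s w\<close>;
            saturatedness of \<open>E\<close> then leads back to \<open>w\<close>.\<close>
          have "a *s w \<in> E (Suc n)" if a: "a \<in> I" for a
          proof (rule step.IH[OF a])
            show "a *s w \<in> G (Suc n)" using gradedD(2)[OF G a] step.prems by blast
            have "a *s (x *s w) \<in> E (Suc (Suc n))" using gradedD(2)[OF E(1) a] step.prems by blast
            then show "x *s (a *s w) \<in> E (Suc (Suc n))" by (simp add: mult.commute)
          qed
          then show ?case using E(3) step.prems(1) by blast
        qed
      qed
      then show ?thesis
        using \<V>(1,2) VI ann v(1) by (intro exI[of _ "insert V \<V>"]) blast
    qed
  qed
  then show ?thesis using assms(3) unfolding G_def by blast
qed

end

section \<open>Artin-Rees and the colon modules\<close>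

context ideal_module
begin

text \<open>For graded \<open>E\<close>, the subfamily generated by the degrees up to
  \<open>k\<close>.\<close>

primrec truncation :: "(nat \<Rightarrow> 'b set) \<Rightarrow> nat \<Rightarrow> nat \<Rightarrow> 'b set" where
  "truncation E k 0 = E 0"
| "truncation E k (Suc n) = (if Suc n \<le> k then E (Suc n) else ideal_smult scale I (truncation E k n))"

lemma truncation_eq: "n \<le> k \<Longrightarrow> truncation E k n = E n"
  by (cases n) auto

lemma ideal_smult_mono: "L \<subseteq> L' \<Longrightarrow> ideal_smult scale I L \<subseteq> ideal_smult scale I L'"
  by (rule ideal_smult_least[OF ideal_smult_subspace]) (auto intro: ideal_smultI)

lemma ideal_smult_graded: "graded E \<Longrightarrow> ideal_smult scale I (E n) \<subseteq> E (Suc n)"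
  by (rule ideal_smult_least[OF gradedD(1) gradedD(2)])

lemma truncation_subset: "graded E \<Longrightarrow> truncation E k n \<subseteq> E n"
proof (induction n)
  case (Suc n)
  then show ?case using ideal_smult_mono[of "truncation E k n" "E n"] ideal_smult_graded[of E n] by auto
qed simp

lemma graded_truncation:
  assumes "graded E"
  shows "graded (truncation E k)"
  unfolding graded_def
proof (intro conjI allI ballI)
  show "subspace (truncation E k n)" for n
    using gradedD(1)[OF assms] by (cases n) (auto simp: ideal_smult_subspace)
  show "a *s v \<in> truncation E k (Suc n)" if "a \<in> I" "v \<in> truncation E k n" for n a v
    using that gradedD(2)[OF assms, of a v n] truncation_subset[OF assms, of k n] by (auto simp: ideal_smultI)
qed

lemma mono_truncation:
  assumes "graded E"
  shows "mono (truncation E)"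
  unfolding mono_iff_le_Suc le_fun_def
proof (intro allI)
  fix k n
  show "truncation E k n \<subseteq> truncation E (Suc k) n"
  proof (induction n)
    case (Suc n)
    consider "Suc n \<le> k" | "n = k" | "Suc k < Suc n" by linarith
    then show ?case
    proof cases
      case 2
      then show ?thesis using ideal_smult_graded[OF assms, of k] by (simp add: truncation_eq)
    qed (use ideal_smult_mono[OF Suc] in auto)
  qed simp
qed

text \<open>The truncations ascend, so they stabilize at some \<open>t\<close>; each degree of
  \<open>E\<close> agrees with a late truncation, so \<open>E\<close> is generated in degrees up to
  \<open>t\<close>.\<close>

lemma artin_rees:
  assumes "acc (range scale) M" "subspace M" "graded E" "\<And>n. E n \<subseteq> adic M n"
  obtains t where "\<And>n. n \<ge> t \<Longrightarrow> E (Suc n) \<subseteq> ideal_smult scale I (E n)"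
proof -
  have "truncation E k n \<subseteq> adic M n" for k n using truncation_subset[OF assms(3)] assms(4) by blast
  from graded_chain_stabilizes[OF assms(1,2) graded_truncation[OF assms(3)] this mono_truncation[OF assms(3)]]
  obtain t where t: "\<And>k. k \<ge> t \<Longrightarrow> truncation E k = truncation E t" by blast
  have "E (Suc n) \<subseteq> ideal_smult scale I (E n)" if "n \<ge> t" for n
  proof -
    have "E (Suc n) = truncation E t (Suc n)"
      using t[of "Suc n"] that truncation_eq[of "Suc n" "Suc n" E] by auto
    also have "\<dots> \<subseteq> ideal_smult scale I (E n)"
      using that ideal_smult_mono[OF truncation_subset[OF assms(3)], of t n] by simp
    finally show ?thesis .
  qed
  then show thesis using that by blast
qed

section \<open>Power torsion and its intersection with the adic filtration\<close>

lemma subspace_colon: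
  assumes N: "subspace N" and T: "subspace T"
  shows "subspace {u \<in> N. \<forall>a\<in>J. a *s u \<in> T}"
proof (rule subspaceI)
  fix r x assume x: "x \<in> {u \<in> N. \<forall>a\<in>J. a *s u \<in> T}"
  have "a *s (r *s x) \<in> T" if "a \<in> J" for a
    unfolding scale_left_commute[of a r x] using x that subspace_scale[OF T] by blast
  then show "r *s x \<in> {u \<in> N. \<forall>a\<in>J. a *s u \<in> T}" using x subspace_scale[OF N] by blast
qed (use subspace_0[OF N] subspace_0[OF T] subspace_add[OF N] subspace_add[OF T]
     in \<open>auto simp: scale_right_distrib\<close>)

text \<open>For a submodule \<open>N\<close> this is \<open>0 :_N I^p\<close>.\<close>

primrec torsion :: "'b set \<Rightarrow> nat \<Rightarrow> 'b set" where
  "torsion N 0 = {0}"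
| "torsion N (Suc p) = {v \<in> N. \<forall>a\<in>I. a *s v \<in> torsion N p}"

lemma subspace_torsion: "subspace N \<Longrightarrow> subspace (torsion N p)"
proof (induction p)
  case (Suc p)
  then show ?case using subspace_colon by simp
qed (simp add: subspace_single_0)

lemma torsion_subset: "subspace N \<Longrightarrow> torsion N p \<subseteq> N"
  by (cases p) (auto simp: subspace_0)

lemma mono_torsion:
  assumes "subspace N"
  shows "mono (torsion N)"
  unfolding mono_iff_le_Suc
proof
  fix p
  show "torsion N p \<subseteq> torsion N (Suc p)"
  proof (induction p)
    case 0
    then show ?case using subspace_0[OF assms] by auto
  next
    case (Suc p)
    then show ?case by (simp only: torsion.simps(2)) blast
  qed
qed

lemma torsion_power: "x \<in> I \<Longrightarrow> v \<in> torsion N p \<Longrightarrow> (x ^ p) *s v = 0"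
proof (induction p arbitrary: v)
  case (Suc p)
  then show ?case using Suc.IH[of "x *s v"] by (simp add: mult.commute)
qed simp

text \<open>Past the Artin-Rees bound every further degree contributes a factor from
  \<open>I\<close>, which lowers the torsion exponent by one; after \<open>s\<close> degrees only 0
  is left.\<close>

lemma adic_Int_torsion:
  assumes M: "acc (range scale) M" "subspace M" and N: "subspace N"
  obtains n0 where "\<And>n. n \<ge> n0 \<Longrightarrow> adic M n \<inter> torsion N s \<subseteq> {0}"
proof -
  define E where "E n = adic M n \<inter> torsion N s" for n
  have "graded E"
    unfolding graded_def E_def
    using subspace_inter[OF adic_subspace[OF M(2)] subspace_torsion[OF N]]
      gradedD(2)[OF graded_adic[OF M(2)]] subspace_scale[OF subspace_torsion[OF N]]
    by blast
  from artin_rees[OF M this]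
  obtain t where t: "\<And>n. n \<ge> t \<Longrightarrow> E (Suc n) \<subseteq> ideal_smult scale I (E n)"
    unfolding E_def by blast
  have "E (t + p) \<subseteq> torsion N (s - p)" for p
  proof (induction p)
    case 0
    then show ?case unfolding E_def by auto
  next
    case (Suc p)
    have "E (t + Suc p) \<subseteq> ideal_smult scale I (E (t + p))" using t[of "t + p"] by simp
    also have "\<dots> \<subseteq> torsion N (s - Suc p)"
    proof (rule ideal_smult_least[OF subspace_torsion[OF N]])
      fix r u assume "r \<in> I" "u \<in> E (t + p)"
      then have u: "u \<in> torsion N (s - p)" using Suc by blast
      show "r *s u \<in> torsion N (s - Suc p)"
      proof (cases "p < s")
        case True
        then have "s - p = Suc (s - Suc p)" by simp
        then show ?thesis using u \<open>r \<in> I\<close> by simp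
      next
        case False
        then show ?thesis using u by simp
      qed
    qed
    finally show ?case .
  qed
  from this[of s] have "E (t + s) \<subseteq> {0}" by simp
  then have "adic M n \<inter> torsion N s \<subseteq> {0}" if "n \<ge> t + s" for n
    using adic_antimono[OF M(2) that] unfolding E_def by blast
  then show thesis using that by blast
qed

text \<open>With \<open>K\<close> the torsion, \<open>x\<close> is a nonzerodivisor on
  \<open>N/K\<close>, and multiplication by a power of \<open>x\<close> carries the problem into
  \<open>I^n M\<close>, where Artin-Rees applies. Cancelling that power gives
  \<open>(I^(n+1) M + K) :_N I \<subseteq> I^n M + K\<close> for \<open>n \<ge> t\<close>, which
  undoes \<open>sat\<close> step by step.\<close>

lemma sat_adic_stable:
  assumes M: "acc (range scale) M" "subspace M" and N: "subspace N" "M \<subseteq> N"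
    and x: "x \<in> I" "\<And>v. v \<in> N \<Longrightarrow> x *s v \<in> torsion N s \<Longrightarrow> v \<in> torsion N s"
  obtains t where "\<And>n v. n \<ge> t \<Longrightarrow> v \<in> N \<Longrightarrow> sat (adic M) n v \<Longrightarrow>
    v \<in> {w + k | w k. w \<in> adic M n \<and> k \<in> torsion N s}"
proof -
  define K where "K = torsion N s"
  have K: "subspace K" "K \<subseteq> N" unfolding K_def using subspace_torsion torsion_subset N by auto
  have xK: "v \<in> K" if "v \<in> N" "(x ^ p) *s v \<in> K" for v p
    using that
  proof (induction p arbitrary: v)
    case (Suc p)
    then have "(x ^ p) *s (x *s v) \<in> K" by (simp add: mult.commute)
    then have "x *s v \<in> K" using Suc subspace_scale[OF N(1)] by blast
    then show ?case using x(2)[OF Suc.prems(1)] unfolding K_def by blast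
  qed simp
  define W where "W n = {w + k | w k. w \<in> adic M n \<and> k \<in> K}" for n
  have W: "subspace (W n)" for n
    unfolding W_def
    using op_sub_sum_set[of "range scale" "adic M n" K] adic_subspace[OF M(2), of n] K(1) additive_scale
    by (auto simp: subspace_iff_op_sub)
  have WI: "a *s w \<in> W (Suc n)" if a: "a \<in> I" and w: "w \<in> W n" for a w n
  proof -
    obtain w' k where "w = w' + k" "w' \<in> adic M n" "k \<in> K" using w unfolding W_def by blast
    moreover from this have "a *s w' \<in> adic M (Suc n)" "a *s k \<in> K"
      using gradedD(2)[OF graded_adic[OF M(2)] a] subspace_scale[OF K(1)] by blast+
    ultimately show ?thesis unfolding W_def by (auto simp: scale_right_distrib simp del: adic.simps)
  qed
  have adicW: "adic M n \<subseteq> W n" for n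
    using subspace_0[OF K(1)] unfolding W_def by force
  have KW: "K \<subseteq> W n" for n
    using subspace_0[OF adic_subspace[OF M(2)]] unfolding W_def by force
  define P where "P n = {u \<in> N. \<forall>a\<in>I. a *s u \<in> W n}" for n
  have P: "graded P"
    unfolding graded_def
  proof (intro conjI allI ballI)
    show "subspace (P n)" for n
      unfolding P_def by (rule subspace_colon[OF N(1) W])
    fix n a v assume a: "a \<in> I" and v: "v \<in> P n"
    have "b *s (a *s v) \<in> W (Suc n)" if "b \<in> I" for b
      using WI[OF a, of "b *s v" n] v that unfolding P_def by (simp add: mult.commute)
    then show "a *s v \<in> P (Suc n)"
      using v subspace_scale[OF N(1)] unfolding P_def by blast
  qed
  \<comment> \<open>One factor \<open>x\<close> moves \<open>P n\<close> into \<open>W n\<close>;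
    the other \<open>s\<close> factors kill the torsion summand, so the result lies in
    \<open>I^n M\<close>.\<close>
  let ?y = "x ^ Suc s"
  define E where "E n = scale ?y ` P n" for n
  have image_subspace: "subspace (scale ?y ` L)" if L: "subspace L" for L
  proof (rule subspaceI)
    show "0 \<in> scale ?y ` L" using subspace_0[OF L] by force
    show "u + v \<in> scale ?y ` L" if "u \<in> scale ?y ` L" "v \<in> scale ?y ` L" for u v
      using that subspace_add[OF L] by (auto simp: scale_right_distrib[symmetric])
    show "r *s u \<in> scale ?y ` L" if "u \<in> scale ?y ` L" for r u
      using that subspace_scale[OF L] scale_left_commute[of r ?y] by blast
  qed
  have "graded E"
    unfolding graded_def E_def
  proof (intro conjI allI ballI image_subspace gradedD(1)[OF P])
    fix n a v assume a: "a \<in> I" and "v \<in> scale ?y ` P n"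
    then obtain u where u: "v = ?y *s u" "u \<in> P n" by blast
    have "a *s v = ?y *s (a *s u)" unfolding u(1) by (rule scale_left_commute)
    then show "a *s v \<in> scale ?y ` P (Suc n)" using gradedD(2)[OF P a u(2)] by blast
  qed
  moreover have "E n \<subseteq> adic M n" for n
  proof
    fix v assume "v \<in> E n"
    then obtain u where u: "v = ?y *s u" "u \<in> P n" unfolding E_def by blast
    then obtain w k where wk: "x *s u = w + k" "w \<in> adic M n" "k \<in> K" using x(1) unfolding P_def W_def by blast
    have "v = (x ^ s) *s (x *s u)" unfolding u(1) by (simp add: mult.commute)
    also have "\<dots> = (x ^ s) *s w"
      using torsion_power[OF x(1)] wk(3) unfolding wk(1) K_def by (simp add: scale_right_distrib)
    finally show "v \<in> adic M n" using subspace_scale[OF adic_subspace[OF M(2)] wk(2)] by simp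
  qed
  ultimately obtain t where t: "\<And>n. n \<ge> t \<Longrightarrow> E (Suc n) \<subseteq> ideal_smult scale I (E n)"
    using artin_rees[OF M] by blast
  have PW: "u \<in> W n" if n: "n \<ge> t" and u: "u \<in> P (Suc n)" for u n
  proof -
    have "ideal_smult scale I (E n) \<subseteq> scale ?y ` (ideal_smult scale I (P n))"
    proof (rule ideal_smult_least[OF image_subspace[OF ideal_smult_subspace]])
      fix r v assume "r \<in> I" "v \<in> E n"
      then obtain u where u: "v = ?y *s u" "u \<in> P n" unfolding E_def by blast
      have "r *s v = ?y *s (r *s u)" unfolding u(1) by (rule scale_left_commute)
      then show "r *s v \<in> scale ?y ` (ideal_smult scale I (P n))"
        using ideal_smultI[OF \<open>r \<in> I\<close> u(2)] by blast
    qed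
    moreover have "?y *s u \<in> E (Suc n)" using u unfolding E_def by blast
    \<comment> \<open>Since \<open>?y\<close> commutes out of the product with \<open>I\<close>,
      Artin-Rees gives \<open>z\<close> in \<open>I P n\<close>, and cancelling \<open>?y\<close>
      modulo \<open>K\<close> compares \<open>u\<close> with \<open>z\<close>.\<close>
    ultimately obtain z where z: "?y *s u = ?y *s z" "z \<in> ideal_smult scale I (P n)"
      using t[OF n] by blast
    have "ideal_smult scale I (P n) \<subseteq> W n"
      by (rule ideal_smult_least[OF W]) (auto simp: P_def)
    then have zW: "z \<in> W n" using z by blast
    have "W n \<subseteq> N"
      using adic_subset[OF M(2), of n] N K(2) subspace_add[OF N(1)] unfolding W_def by blast
    then have "u - z \<in> N" using zW u subspace_diff[OF N(1)] unfolding P_def by blast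
    moreover have "?y *s (u - z) \<in> K" using z(1) subspace_0[OF K(1)] by (simp only: scale_right_diff_distrib) simp
    ultimately have "u - z \<in> W n" using xK KW by blast
    from subspace_add[OF W zW this] show ?thesis by simp
  qed
  \<comment> \<open>Derivations of \<open>sat\<close> only move upward in \<open>n\<close>, so the
    bound persists along them.\<close>
  have "n \<ge> t \<longrightarrow> v \<in> N \<longrightarrow> v \<in> W n" if "sat (adic M) n v" for n v
    using that
  proof (induction rule: sat.induct)
    case (base v n)
    then show ?case using adicW by blast
  next
    case (step n v)
    show ?case
    proof (intro impI)
      assume "n \<ge> t" "v \<in> N"
      then have "v \<in> P (Suc n)" using step.IH subspace_scale[OF N(1)] unfolding P_def by simp
      then show "v \<in> W n" using PW \<open>n \<ge> t\<close> by blast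
    qed
  qed
  then show thesis using that[of t] unfolding W_def K_def by blast
qed

text \<open>The assumption on \<open>x\<close> says that it is superficial up to saturation: if
  \<open>x\<close> raises the degree of \<open>v\<close> by one more than expected, then
  \<open>v\<close> gains a degree after multiplication by elements of \<open>I\<close>. Repeating
  this \<open>q\<close> times uses up the whole excess.\<close>

lemma superficial_sat:
  assumes "subspace M"
    and x: "x \<in> I" "\<And>n v. v \<in> adic M n \<Longrightarrow> x *s v \<in> adic M (Suc (Suc n)) \<Longrightarrow> sat (\<lambda>j. adic M (Suc j)) n v"
    and v: "v \<in> adic M j" "x *s v \<in> adic M (Suc (j + q))"
  shows "sat (adic M) (j + q) v"
  using v
proof (induction q arbitrary: j v)
  case 0
  then show ?case by (simp add: sat.base)
next
  case (Suc q)
  have "adic M (Suc (j + Suc q)) \<subseteq> adic M (Suc (Suc j))"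
    by (rule adic_antimono[OF assms(1)]) simp
  then have "sat (\<lambda>j. adic M (Suc j)) j v" using x(2) Suc.prems by blast
  then show ?case
    using Suc.prems(2)
  proof (induction rule: sat.induct)
    case (base v j)
    then show ?case using Suc.IH[of v "Suc j"] by simp
  next
    case (step j v)
    show ?case
    proof (rule sat.step)
      fix a assume a: "a \<in> I"
      have "a *s (x *s v) \<in> adic M (Suc (Suc (j + Suc q)))"
        using gradedD(2)[OF graded_adic[OF assms(1)] a] step.prems by blast
      then show "sat (adic M) (Suc (j + Suc q)) (a *s v)"
        using step.IH[OF a] by (simp add: mult.commute del: adic.simps)
    qed
  qed
qed

text \<open>Multiplying by elements of \<open>I\<close> until \<open>M\<close> is reached reduces to
  \<open>superficial_sat\<close> started in degree 0.\<close>

lemma superficial_sat_ambient: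
  assumes "subspace M"
    and x: "x \<in> I" "\<And>n v. v \<in> adic M n \<Longrightarrow> x *s v \<in> adic M (Suc (Suc n)) \<Longrightarrow> sat (\<lambda>j. adic M (Suc j)) n v"
    and v: "sat (\<lambda>j. M) i v" "x *s v \<in> adic M (Suc q)"
  shows "sat (adic M) q v"
  using v
proof (induction arbitrary: q rule: sat.induct)
  case (base v n)
  then show ?case using superficial_sat[OF assms(1) x, of v 0 q] by simp
next
  case (step n v)
  show ?case
  proof (rule sat.step)
    fix a assume a: "a \<in> I"
    have "a *s (x *s v) \<in> adic M (Suc (Suc q))"
      using gradedD(2)[OF graded_adic[OF assms(1)] a] step.prems by blast
    then show "sat (adic M) (Suc q) (a *s v)"
      using step.IH[OF a] by (simp add: mult.commute del: adic.simps)
  qed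
qed

text \<open>The hypothesis \<open>avoid\<close> carries in what the infinite residue field provides.
  It yields the auxiliary \<open>x0\<close> behind the uniform bound; the exceptional ideals of the
  conclusion come from \<open>N\<close> relative to \<open>M\<close> and from the associated graded
  module of \<open>M\<close>.\<close>

lemma colon_adic_eq:
  assumes M: "acc (range scale) M" "subspace M" and N: "acc (range scale) N" "subspace N" and MN: "M \<subseteq> N"
    and avoid: "\<And>\<V>. finite \<V> \<Longrightarrow> \<forall>V\<in>\<V>. is_ideal V \<and> V \<subset> I \<Longrightarrow> I - \<Union>\<V> \<noteq> {}"
  shows "\<exists>t>0. \<exists>\<V>. finite \<V> \<and> (\<forall>V\<in>\<V>. is_ideal V \<and> V \<subset> I) \<and>
    (\<forall>x\<in>I - \<Union>\<V>. \<forall>J. is_ideal J \<and> x \<in> J \<and> J \<subseteq> I \<longrightarrow>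
      (\<forall>n\<ge>t. colon_mod scale (adic M n) N J = submod_sum (colon_mod scale {0} N J) (adic M (n - 1))))"
proof -
  obtain s where s: "\<And>n. n \<ge> s \<Longrightarrow> torsion N n = torsion N s"
    using accD[OF N(1), of "torsion N"] subspace_torsion[OF N(2)] torsion_subset[OF N(2)] mono_torsion[OF N(2)]
    by (auto simp: subspace_iff_op_sub)
  have K: "v \<in> torsion N s" if "v \<in> N" "\<And>a. a \<in> I \<Longrightarrow> a *s v \<in> torsion N s" for v
    using s[of "Suc s"] that by auto
  define W where "W n = {w + k | w k. w \<in> adic M n \<and> k \<in> torsion N s}" for n

  have "saturated (adic N) (\<lambda>n. adic N n \<inter> torsion N s)"
    unfolding saturated_def graded_def
    using subspace_inter[OF adic_subspace[OF N(2)] subspace_torsion[OF N(2)]]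
      gradedD(2)[OF graded_adic[OF N(2)]] subspace_scale[OF subspace_torsion[OF N(2)]]
      adic_subset[OF N(2)] K
    by blast
  from finite_exceptional_ideals[OF N this] obtain \<V>\<^sub>0 where
    "finite \<V>\<^sub>0" "\<forall>V\<in>\<V>\<^sub>0. is_ideal V \<and> V \<subset> I"
    and V0: "\<forall>x\<in>I - \<Union>\<V>\<^sub>0. \<forall>n. \<forall>v\<in>adic N n. x *s v \<in> adic N (Suc n) \<inter> torsion N s \<longrightarrow> v \<in> adic N n \<inter> torsion N s"
    by meson
  then obtain x0 where x0: "x0 \<in> I - \<Union>\<V>\<^sub>0" using avoid by blast
  \<comment> \<open>In degree 0 this makes \<open>x0\<close> a nonzerodivisor modulo the torsion.
    The bound \<open>t\<close> is read off from \<open>x0\<close>, hence is the same for all later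
    \<open>x\<close>.\<close>
  have "v \<in> torsion N s" if "v \<in> N" "x0 *s v \<in> torsion N s" for v
    using V0[rule_format, OF x0, of v 0] that gradedD(2)[OF graded_adic[OF N(2)], of x0 v 0] x0 by simp
  from sat_adic_stable[OF M N(2) MN _ this, of x0] x0
  obtain t where t: "\<And>n v. n \<ge> t \<Longrightarrow> v \<in> N \<Longrightarrow> sat (adic M) n v \<Longrightarrow> v \<in> W n"
    unfolding W_def by auto
  obtain n0 where n0: "\<And>n. n \<ge> n0 \<Longrightarrow> adic M n \<inter> torsion N s \<subseteq> {0}"
    using adic_Int_torsion[OF M N(2)] by blast

  have gM: "graded (\<lambda>j. M)" using M(2) subspace_scale unfolding graded_def by blast
  \<comment> \<open>Outside these ideals, \<open>x\<close> cannot bring an element of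
    \<open>N\<close> into \<open>M\<close> unless repeated multiplication by \<open>I\<close> does
    so as well.\<close>
  obtain \<V>\<^sub>1 where \<V>1: "finite \<V>\<^sub>1" "\<forall>V\<in>\<V>\<^sub>1. is_ideal V \<and> V \<subset> I"
    "\<forall>x\<in>I - \<Union>\<V>\<^sub>1. \<forall>n. \<forall>v\<in>adic N n. x *s v \<in> saturation (adic N) (\<lambda>j. M) (Suc n)
      \<longrightarrow> v \<in> saturation (adic N) (\<lambda>j. M) n"
    using finite_exceptional_ideals[OF N saturated_saturation[OF graded_adic[OF N(2)] gM]] by meson
  \<comment> \<open>The shifted family is the denominator of the associated graded module of
    \<open>M\<close>; avoiding \<open>\<V>\<^sub>2\<close> makes \<open>x\<close> superficial up to
    saturation.\<close>
  have gM': "graded (\<lambda>j. adic M (Suc j))"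
    using graded_adic[OF M(2)] unfolding graded_def by (simp del: adic.simps)
  obtain \<V>\<^sub>2 where \<V>2: "finite \<V>\<^sub>2" "\<forall>V\<in>\<V>\<^sub>2. is_ideal V \<and> V \<subset> I"
    "\<forall>x\<in>I - \<Union>\<V>\<^sub>2. \<forall>n. \<forall>v\<in>adic M n. x *s v \<in> saturation (adic M) (\<lambda>j. adic M (Suc j)) (Suc n)
      \<longrightarrow> v \<in> saturation (adic M) (\<lambda>j. adic M (Suc j)) n"
    using finite_exceptional_ideals[OF M saturated_saturation[OF graded_adic[OF M(2)] gM']] by meson

  have eq: "colon_mod scale (adic M n) N J = submod_sum (colon_mod scale {0} N J) (adic M (n - 1))"
    if x: "x \<in> I - \<Union>(\<V>\<^sub>1 \<union> \<V>\<^sub>2)" and J: "x \<in> J" "J \<subseteq> I" and n: "n \<ge> Suc (max t n0)" for x J n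
  proof
    \<comment> \<open>Passing from \<open>x *s u\<close> to \<open>u\<close> costs one degree, so
      the bounds must hold for \<open>n - 1\<close>. The successor also makes the threshold
      positive.\<close>
    obtain q where q: "n = Suc q" "q \<ge> t" "q \<ge> n0" using n by (cases n) auto
    show "submod_sum (colon_mod scale {0} N J) (adic M (n - 1)) \<subseteq> colon_mod scale (adic M n) N J"
    proof
      fix u assume "u \<in> submod_sum (colon_mod scale {0} N J) (adic M (n - 1))"
      then obtain v w where u: "u = v + w" "v \<in> N" "\<forall>r\<in>J. r *s v = 0" "w \<in> adic M q"
        unfolding submod_sum_def colon_mod_def q by auto
      have "r *s u \<in> adic M n" if "r \<in> J" for r
        using u that J(2) gradedD(2)[OF graded_adic[OF M(2)], of r w q] unfolding q
        by (auto simp: scale_right_distrib simp del: adic.simps)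
      moreover have "u \<in> N" using u adic_subset[OF M(2), of q] MN subspace_add[OF N(2)] by blast
      ultimately show "u \<in> colon_mod scale (adic M n) N J" unfolding colon_mod_def by blast
    qed
    show "colon_mod scale (adic M n) N J \<subseteq> submod_sum (colon_mod scale {0} N J) (adic M (n - 1))"
    proof
      fix u assume "u \<in> colon_mod scale (adic M n) N J"
      then have u: "u \<in> N" "\<And>r. r \<in> J \<Longrightarrow> r *s u \<in> adic M n" unfolding colon_mod_def by auto
      have x2: "sat (\<lambda>j. adic M (Suc j)) n v" if v: "v \<in> adic M n" "x *s v \<in> adic M (Suc (Suc n))" for n v
      proof -
        have "x *s v \<in> adic M (Suc n)" using gradedD(2)[OF graded_adic[OF M(2)]] v(1) x by blast
        then have "x *s v \<in> saturation (adic M) (\<lambda>j. adic M (Suc j)) (Suc n)"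
          using sat.base[of "x *s v" "\<lambda>j. adic M (Suc j)" "Suc n"] v(2) unfolding saturation_def by blast
        then show ?thesis using \<V>2(3) x v(1) unfolding saturation_def by blast
      qed
      have "x *s u \<in> M" using u(2)[OF J(1)] adic_subset[OF M(2)] by blast
      moreover have "x *s u \<in> adic N (Suc 0)" using gradedD(2)[OF graded_adic[OF N(2)], of x u 0] x u(1) by simp
      ultimately have "x *s u \<in> saturation (adic N) (\<lambda>j. M) (Suc 0)"
        using sat.base[of "x *s u" "\<lambda>j. M" "Suc 0"] unfolding saturation_def by blast
      moreover have "u \<in> adic N 0" using u(1) by simp
      ultimately have "sat (\<lambda>j. M) 0 u" using \<V>1(3) x unfolding saturation_def by blast
      then have "sat (adic M) q u"
        using superficial_sat_ambient[OF M(2) _ x2, of x 0 u q] x u(2)[OF J(1)] q(1) by blast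
      then obtain w k where wk: "u = w + k" "w \<in> adic M q" "k \<in> torsion N s"
        using t[OF q(2) u(1)] unfolding W_def by blast
      \<comment> \<open>The element lies in \<open>I^n M\<close>, being a difference of two elements
        of it, and also in the torsion; for large \<open>n\<close> these meet only in 0.\<close>
      have "r *s k = 0" if r: "r \<in> J" for r
      proof -
        have "r *s w \<in> adic M n" using gradedD(2)[OF graded_adic[OF M(2)] _ wk(2)] r J(2) q(1) by blast
        moreover have "r *s k = r *s u - r *s w" using wk(1) by (simp add: scale_right_distrib)
        ultimately have "r *s k \<in> adic M n" using u(2)[OF r] subspace_diff[OF adic_subspace[OF M(2)]] by metis
        moreover have "r *s k \<in> torsion N s" using wk(3) subspace_scale[OF subspace_torsion[OF N(2)]] by blast
        ultimately show ?thesis using n0[of n] q by auto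
      qed
      then have "k \<in> colon_mod scale {0} N J"
        using wk(3) torsion_subset[OF N(2), of s] unfolding colon_mod_def by blast
      moreover have "u = k + w" using wk(1) by (simp add: add.commute)
      ultimately show "u \<in> submod_sum (colon_mod scale {0} N J) (adic M (n - 1))"
        using wk(2) q(1) unfolding submod_sum_def by auto
    qed
  qed
  show ?thesis
  proof (intro exI[of _ "Suc (max t n0)"] conjI exI[of _ "\<V>\<^sub>1 \<union> \<V>\<^sub>2"] ballI allI impI)
    show "finite (\<V>\<^sub>1 \<union> \<V>\<^sub>2)" using \<V>1(1) \<V>2(1) by simp
    show "is_ideal V" "V \<subset> I" if "V \<in> \<V>\<^sub>1 \<union> \<V>\<^sub>2" for V using that \<V>1(2) \<V>2(2) by blast+
  qed (use eq in simp_all)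
qed

section \<open>Comparison of the recursive filtration with powers of the ideal\<close>

lemma adic_eq: "ideal_smult scale (ideal_pow I n) M = adic M n" if "subspace M"
proof (induction n)
  case 0
  show ?case
  proof
    show "ideal_smult scale (ideal_pow I 0) M \<subseteq> adic M 0"
      by (rule ideal_smult_least) (use that subspace_scale in auto)
    show "adic M 0 \<subseteq> ideal_smult scale (ideal_pow I 0) M"
      using ideal_smultI[of 1 UNIV _ M] by auto
  qed
next
  case (Suc n)
  show ?case
  proof
    show "ideal_smult scale (ideal_pow I (Suc n)) M \<subseteq> adic M (Suc n)"
    proof (rule ideal_smult_least[OF adic_subspace[OF that]])
      fix r u assume r: "r \<in> ideal_pow I (Suc n)" and u: "u \<in> M"
      have "b *s u \<in> adic M n" if "b \<in> ideal_pow I n" for b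
        using ideal_smultI[OF that u] Suc by simp
      then have "{a * b | a b. a \<in> I \<and> b \<in> ideal_pow I n} \<subseteq> {r. r *s u \<in> adic M (Suc n)}"
        using gradedD(2)[OF graded_adic[OF \<open>subspace M\<close>]] by (auto simp flip: scale_scale simp del: adic.simps)
      then have "ideal_pow I (Suc n) \<subseteq> {r. r *s u \<in> adic M (Suc n)}"
        unfolding ideal_pow.simps
        by (rule ideal_gen_least[OF subspace_scalars_into[OF adic_subspace[OF \<open>subspace M\<close>]]])
      then show "r *s u \<in> adic M (Suc n)" using r by blast
    qed
    have "r *s w \<in> ideal_smult scale (ideal_pow I (Suc n)) M" if r: "r \<in> I" and w: "w \<in> adic M n" for r w
    proof -
      have "adic M n \<subseteq> {w. r *s w \<in> ideal_smult scale (ideal_pow I (Suc n)) M}"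
        unfolding Suc[symmetric]
      proof (rule ideal_smult_least[OF subspace_vimage_scale[OF ideal_smult_subspace]])
        fix b u assume bu: "b \<in> ideal_pow I n" "u \<in> M"
        then have "r * b \<in> ideal_pow I (Suc n)"
          using r subset_ideal_gen[of "{a * b | a b. a \<in> I \<and> b \<in> ideal_pow I n}"] by auto
        from ideal_smultI[OF this bu(2)]
        show "b *s u \<in> {w. r *s w \<in> ideal_smult scale (ideal_pow I (Suc n)) M}" by simp
      qed
      then show ?thesis using w by blast
    qed
    then show "adic M (Suc n) \<subseteq> ideal_smult scale (ideal_pow I (Suc n)) M"
      unfolding adic.simps by (rule ideal_smult_least[OF ideal_smult_subspace])
  qed
qed

end

section \<open>Zariski open sets over a local ring\<close>

lemma is_ideal_diff: "is_ideal J \<Longrightarrow> a \<in> J \<Longrightarrow> b \<in> J \<Longrightarrow> a - b \<in> J"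
  using op_subD(2) is_ideal_iff_op_sub by blast

lemma is_idealD:
  assumes "is_ideal J"
  shows "0 \<in> J" "a \<in> J \<Longrightarrow> b \<in> J \<Longrightarrow> a + b \<in> J" "a \<in> J \<Longrightarrow> r * a \<in> J"
  using assms unfolding is_ideal_def by auto

lemma is_ideal_adjoin:
  assumes W: "is_ideal W"
  shows "is_ideal {w + r * e | w r. w \<in> W}"
  unfolding is_ideal_def
proof (intro conjI allI ballI)
  have "0 = 0 + 0 * e" by simp
  then show "0 \<in> {w + r * e | w r. w \<in> W}" using is_idealD(1)[OF W] by blast
  fix a b assume "a \<in> {w + r * e | w r. w \<in> W}" "b \<in> {w + r * e | w r. w \<in> W}"
  then obtain w r w' r' where *: "a = w + r * e" "b = w' + r' * e" "w \<in> W" "w' \<in> W" by blast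
  then have "a + b = (w + w') + (r + r') * e" by (simp add: algebra_simps)
  then show "a + b \<in> {w + r * e | w r. w \<in> W}" using is_idealD(2)[OF W *(3,4)] by blast
next
  fix s a assume "a \<in> {w + r * e | w r. w \<in> W}"
  then obtain w r where *: "a = w + r * e" "w \<in> W" by blast
  then have "s * a = s * w + (s * r) * e" by (simp add: algebra_simps)
  then show "s * a \<in> {w + r * e | w r. w \<in> W}" using is_idealD(3)[OF W *(2)] by blast
qed

section \<open>Units, avoidance and linear functionals over the local ring\<close>

locale noetherian_local =
  fixes m :: "'a::comm_ring_1 set"
  assumes noeth: "noetherian_ring TYPE('a)" and local: "local_ring_max m"
begin

lemma m_ideal: "is_ideal m" and m_proper: "1 \<notin> m"
proof -
  show m: "is_ideal m" using local unfolding local_ring_max_def maximal_ideal_def by blast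
  show "1 \<notin> m"
  proof
    assume "1 \<in> m"
    then have "r \<in> m" for r using is_idealD(3)[OF m, of 1 r] by simp
    then show False using local unfolding local_ring_max_def maximal_ideal_def by blast
  qed
qed

text \<open>A non-unit generates an ideal without 1; a maximal such ideal above it is a maximal
  ideal, hence \<open>m\<close>.\<close>

lemma ex_inverse_if_notin: "r \<notin> m \<Longrightarrow> \<exists>s. s * r = 1"
proof (rule ccontr)
  assume r: "r \<notin> m" and no: "\<nexists>s. s * r = 1"
  let ?J = "{w + s * r | w s. w \<in> {0}}" and ?\<J> = "{J :: 'a set. is_ideal J \<and> 1 \<notin> J}"
  have "is_ideal {0 :: 'a}" by (simp add: is_ideal_def)
  then have "is_ideal ?J" by (rule is_ideal_adjoin)
  moreover have "1 \<notin> ?J" using no by auto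
  ultimately have "?J \<in> ?\<J>" by simp
  then obtain K where K: "K \<in> ?\<J>" "?J \<subseteq> K" "\<And>K'. K' \<in> ?\<J> \<Longrightarrow> K \<subseteq> K' \<Longrightarrow> K' = K"
    using maximal_ideal_exists[OF noeth, of ?J ?\<J>] by (metis (no_types, lifting) mem_Collect_eq)
  have "maximal_ideal K"
    unfolding maximal_ideal_def
  proof (intro conjI allI impI)
    fix J assume J: "is_ideal J" "K \<subseteq> J"
    show "J = K \<or> J = UNIV"
    proof (cases "1 \<in> J")
      case True
      then show ?thesis using is_idealD(3)[OF J(1), of 1] by auto
    next
      case False
      then show ?thesis using K(3) J by blast
    qed
  qed (use K(1) in auto)
  then have "K = m" using local unfolding local_ring_max_def by blast
  moreover have "r = 0 + 1 * r" by simp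
  then have "r \<in> ?J" by blast
  ultimately show False using r K(2) by blast
qed

lemma unit_mult_in_ideal: "is_ideal J \<Longrightarrow> r \<notin> m \<Longrightarrow> r * a \<in> J \<Longrightarrow> a \<in> J"
  using ex_inverse_if_notin[of r] is_idealD(3)[of J "r * a"] by (metis mult.assoc mult_1)

text \<open>If \<open>x\<close> avoids the old ideals and \<open>y\<close> the new one, then points
  \<open>x + c * y\<close> are tried. Each old ideal excludes at most one residue class of
  \<open>c\<close>: two such points in different classes would put \<open>y\<close>, and then
  \<open>x\<close>, into it.\<close>

lemma finite_ideal_avoidance:
  fixes I :: "'a set"
  assumes inf: "infinite (residue_field m)" and I: "is_ideal I"
    and "finite \<V>" "\<forall>V\<in>\<V>. is_ideal V \<and> V \<subset> I"
  shows "I - \<Union>\<V> \<noteq> {}"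
  using assms(3,4)
proof (induction \<V>)
  case empty
  then show ?case using is_idealD(1)[OF I] by auto
next
  case (insert W \<V>)
  then obtain x where x: "x \<in> I" "x \<notin> \<Union>\<V>" by auto
  obtain y where y: "y \<in> I" "y \<notin> W" using insert.prems by blast
  have W: "is_ideal W" using insert.prems by simp
  show ?case
  proof (cases "x \<in> W")
    case False
    then show ?thesis using x by blast
  next
    case True
    define coset where "coset r = {r + y | y. y \<in> m}" for r
    have coset: "coset c = coset c'" if c: "c - c' \<in> m" for c c'
    proof (intro equalityI subsetI)
      fix z assume "z \<in> coset c"
      then obtain u where "z = c + u" "u \<in> m" unfolding coset_def by blast
      then have "z = c' + ((c - c') + u)" "(c - c') + u \<in> m" using is_idealD(2)[OF m_ideal] c by auto
      then show "z \<in> coset c'" unfolding coset_def by blast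
    next
      fix z assume "z \<in> coset c'"
      then obtain u where "z = c' + u" "u \<in> m" unfolding coset_def by blast
      then have "z = c + (u - (c - c'))" "u - (c - c') \<in> m" using is_ideal_diff[OF m_ideal] c by auto
      then show "z \<in> coset c" unfolding coset_def by blast
    qed
    have fin: "finite (coset ` S)" if S: "\<And>c c'. c \<in> S \<Longrightarrow> c' \<in> S \<Longrightarrow> c - c' \<in> m" for S
    proof (cases "S = {}")
      case False
      then obtain c where "c \<in> S" by blast
      then have "coset ` S \<subseteq> {coset c}" using S coset by blast
      then show ?thesis by (rule finite_subset) simp
    qed simp
    have "finite (coset ` {c. x + c * y \<in> V})" if V: "V \<in> \<V>" for V
    proof (rule fin, rule ccontr)
      fix c c' assume c: "c \<in> {c. x + c * y \<in> V}" "c' \<in> {c. x + c * y \<in> V}" "c - c' \<notin> m"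
      have idV: "is_ideal V" using insert.prems V by blast
      have "(x + c * y) - (x + c' * y) \<in> V" using c is_ideal_diff[OF idV] by blast
      then have "(c - c') * y \<in> V" by (simp add: algebra_simps)
      then have "y \<in> V" using unit_mult_in_ideal[OF idV c(3)] by blast
      then have "(x + c * y) - c * y \<in> V" using c(1) is_ideal_diff[OF idV] is_idealD(3)[OF idV] by blast
      then show False using x(2) V by auto
    qed
    \<comment> \<open>The class of \<open>m\<close> is discarded too: for a unit \<open>c\<close>,
      the point stays outside \<open>W\<close> because \<open>x\<close> lies in \<open>W\<close> and
      \<open>y\<close> does not.\<close>
    moreover have "finite (coset ` m)" by (rule fin) (rule is_ideal_diff[OF m_ideal])
    ultimately have "finite (coset ` m \<union> (\<Union>V\<in>\<V>. coset ` {c. x + c * y \<in> V}))" using insert.hyps(1) by blast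
    moreover have "infinite (range coset)" using inf unfolding residue_field_def coset_def .
    ultimately have "\<not> range coset \<subseteq> coset ` m \<union> (\<Union>V\<in>\<V>. coset ` {c. x + c * y \<in> V})"
      using finite_subset by blast
    then obtain c where c: "c \<notin> m" "\<And>V. V \<in> \<V> \<Longrightarrow> x + c * y \<notin> V" by blast
    have "x + c * y \<notin> W"
    proof
      assume "x + c * y \<in> W"
      then have "(x + c * y) - x \<in> W" using True is_ideal_diff[OF W] by blast
      then show False using unit_mult_in_ideal[OF W c(1), of y] y(2) by simp
    qed
    moreover have "x + c * y \<in> I" using x(1) y(1) is_idealD(2,3)[OF I] by blast
    ultimately show ?thesis using c(2) by blast
  qed
qed

text \<open>For a maximal proper subideal \<open>W\<close> of \<open>I\<close> the quotient \<open>I/W\<close> is a one-dimensional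
  vector space over the residue field.\<close>

lemma functional_vanishing_on:
  assumes I: "is_ideal I" and V: "is_ideal V" "V \<subset> I"
  obtains \<phi> W where "lin_functional m I \<phi>" "is_ideal W" "V \<subseteq> W" "W \<subset> I" "\<And>x. x \<in> I \<Longrightarrow> \<phi> x \<in> m \<longleftrightarrow> x \<in> W"
proof -
  let ?\<J> = "{J. is_ideal J \<and> J \<subset> I}"
  have "V \<in> ?\<J>" using V by simp
  then obtain W where "W \<in> ?\<J>" and VW: "V \<subseteq> W"
    and max: "\<And>K'. K' \<in> ?\<J> \<Longrightarrow> W \<subseteq> K' \<Longrightarrow> K' = W"
    using maximal_ideal_exists[OF noeth, of V ?\<J>] by (metis (no_types, lifting) mem_Collect_eq)
  then have W: "is_ideal W" "W \<subset> I" by auto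
  then obtain e where e: "e \<in> I" "e \<notin> W" by blast
  have adjoin: "\<exists>w r. y = w + r * d \<and> w \<in> W" if d: "d \<in> I" "d \<notin> W" and y: "y \<in> I" for d y
  proof -
    let ?K = "{w + r * d | w r. w \<in> W}"
    have "d = 0 + 1 * d" by simp
    then have "d \<in> ?K" using is_idealD(1)[OF W(1)] by blast
    then have "?K \<noteq> W" using d by blast
    moreover have "W \<subseteq> ?K"
    proof
      fix w assume "w \<in> W"
      moreover have "w = w + 0 * d" by simp
      ultimately show "w \<in> ?K" by blast
    qed
    moreover have "?K \<subseteq> I" using W(2) d(1) is_idealD(2,3)[OF I] by blast
    ultimately have "?K = I" using max[of ?K] is_ideal_adjoin[OF W(1), of d] by blast
    then show ?thesis using y by blast
  qed
  \<comment> \<open>A Nakayama-type argument: if \<open>r \<in> m\<close> but \<open>r * e\<close>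
    is outside \<open>W\<close>, then \<open>e\<close> is a multiple of \<open>r * e\<close> modulo
    \<open>W\<close>, and the unit \<open>1 - s * r\<close> sends \<open>e\<close> into
    \<open>W\<close>.\<close>
  have in_m: "r * e \<in> W \<longleftrightarrow> r \<in> m" for r
  proof
    show "r \<in> m" if "r * e \<in> W" using unit_mult_in_ideal[OF W(1) _ that] e(2) by blast
    show "r * e \<in> W" if r: "r \<in> m"
    proof (rule ccontr)
      assume "r * e \<notin> W"
      then obtain w s where ws: "e = w + s * (r * e)" "w \<in> W"
        using adjoin[of "r * e" e] is_idealD(3)[OF I e(1)] e(1) by blast
      have "(1 - s * r) * e = e - s * (r * e)" by (simp add: algebra_simps)
      also have "\<dots> = w" using ws(1) by (metis add_diff_cancel_right')
      finally have *: "(1 - s * r) * e \<in> W" using ws(2) by simp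
      have "1 - s * r \<notin> m"
        using is_idealD(2)[OF m_ideal, of "1 - s * r" "s * r"] is_idealD(3)[OF m_ideal r] m_proper by auto
      then show False using unit_mult_in_ideal[OF W(1) _ *] e(2) by blast
    qed
  qed
  \<comment> \<open>The coordinate of \<open>y\<close> with respect to the basis vector
    \<open>e\<close> of \<open>I/W\<close>. The choice is arbitrary, but by \<open>in_m\<close> it
    is determined modulo \<open>m\<close> for \<open>y\<close> in \<open>I\<close>.\<close>
  define \<phi> where "\<phi> y = (SOME r. y - r * e \<in> W)" for y
  have \<phi>: "y - \<phi> y * e \<in> W" if y: "y \<in> I" for y
  proof -
    obtain w r where "y = w + r * e" "w \<in> W" using adjoin[OF e y] by blast
    then have "y - r * e \<in> W" by simp
    then show ?thesis unfolding \<phi>_def by (rule someI)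
  qed
  have "lin_functional m I \<phi>"
    unfolding lin_functional_def
  proof (intro conjI ballI allI)
    fix x y assume xy: "x \<in> I" "y \<in> I"
    have "(x - \<phi> x * e) + (y - \<phi> y * e) - (x + y - \<phi> (x + y) * e) \<in> W"
      using is_ideal_diff[OF W(1)] is_idealD(2)[OF W(1)] \<phi>[OF xy(1)] \<phi>[OF xy(2)] \<phi>[OF is_idealD(2)[OF I xy]] by blast
    then have "(\<phi> (x + y) - \<phi> x - \<phi> y) * e \<in> W" by (simp add: algebra_simps)
    then show "\<phi> (x + y) - \<phi> x - \<phi> y \<in> m" using in_m by blast
  next
    fix r x assume x: "x \<in> I"
    have "r * (x - \<phi> x * e) - (r * x - \<phi> (r * x) * e) \<in> W"
      using is_ideal_diff[OF W(1)] is_idealD(3)[OF W(1)] \<phi>[OF x] \<phi>[OF is_idealD(3)[OF I x]] by blast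
    then have "(\<phi> (r * x) - r * \<phi> x) * e \<in> W" by (simp add: algebra_simps)
    then show "\<phi> (r * x) - r * \<phi> x \<in> m" using in_m by blast
  qed
  moreover have "\<phi> x \<in> m \<longleftrightarrow> x \<in> W" if x: "x \<in> I" for x
  proof
    assume "\<phi> x \<in> m"
    then have "(x - \<phi> x * e) + \<phi> x * e \<in> W" using in_m \<phi>[OF x] is_idealD(2)[OF W(1)] by blast
    then show "x \<in> W" by simp
  next
    assume "x \<in> W"
    then have "x - (x - \<phi> x * e) \<in> W" using \<phi>[OF x] is_ideal_diff[OF W(1)] by blast
    then show "\<phi> x \<in> m" using in_m by simp
  qed
  ultimately show thesis using that W VW by blast
qed

text \<open>A product of functionals, one for each ideal. Enlarging the given ideals to the kernels
  \<W> makes the nonvanishing locus known exactly, so that its nonemptiness is again an avoidance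
  statement.\<close>

lemma polyfun_avoiding:
  assumes I: "is_ideal I" and "finite \<V>" "\<forall>V\<in>\<V>. is_ideal V \<and> V \<subset> I"
  shows "\<exists>f\<in>polyfun m I. \<exists>\<W>. finite \<W> \<and> (\<forall>W\<in>\<W>. is_ideal W \<and> W \<subset> I) \<and> \<Union>\<V> \<subseteq> \<Union>\<W> \<and>
    (\<forall>x\<in>I. f x \<notin> m \<longleftrightarrow> x \<notin> \<Union>\<W>)"
  using assms(2,3)
proof (induction \<V>)
  case empty
  show ?case
    by (intro bexI[of _ "\<lambda>x. 1"] exI[of _ "{}"] polyfun.const) (simp add: m_proper)
next
  case (insert V \<V>)
  then obtain f \<W> where f: "f \<in> polyfun m I" and \<W>: "finite \<W>" "\<forall>W\<in>\<W>. is_ideal W \<and> W \<subset> I"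
    "\<Union>\<V> \<subseteq> \<Union>\<W>" "\<forall>x\<in>I. f x \<notin> m \<longleftrightarrow> x \<notin> \<Union>\<W>" by auto
  obtain \<phi> W where W: "lin_functional m I \<phi>" "is_ideal W" "V \<subseteq> W" "W \<subset> I" "\<And>x. x \<in> I \<Longrightarrow> \<phi> x \<in> m \<longleftrightarrow> x \<in> W"
    using functional_vanishing_on[OF I, of V] insert.prems by blast
  have prime: "a * b \<in> m \<longleftrightarrow> a \<in> m \<or> b \<in> m" for a b
    using unit_mult_in_ideal[OF m_ideal, of a b] is_idealD(3)[OF m_ideal] by (metis mult.commute)
  have "(\<lambda>x. \<phi> x * f x) \<in> polyfun m I" by (intro polyfun.mult polyfun.lin W(1) f)
  then show ?case
  proof (rule bexI[rotated], intro exI[of _ "insert W \<W>"] conjI)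
    show "\<forall>x\<in>I. \<phi> x * f x \<notin> m \<longleftrightarrow> x \<notin> \<Union>(insert W \<W>)" using W(5) \<W>(4) prime by simp
  qed (use W(2-4) \<W>(1-3) in auto)
qed

end

section \<open>Assembly of the general colon formula\<close>

theorem theorem2p2:
  fixes m I :: "'a::comm_ring_1 set"
    and scale :: "'a \<Rightarrow> 'b::ab_group_add \<Rightarrow> 'b"
    and M N :: "'b set"
  assumes "noetherian_ring TYPE('a)"
    and "local_ring_max m"
    and "infinite (residue_field m)"
    and "is_ideal I"
    and "module scale"
    and "module.subspace scale M" and "module.subspace scale N"
    and "fg_submodule scale M" and "fg_submodule scale N"
    and "M \<subseteq> N"
  shows "\<exists>t::nat. t > 0 \<and> (\<exists>F \<subseteq> polyfun m I.
           zariski_open_pre m I F \<noteq> {} \<and>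
           (\<forall>x \<in> zariski_open_pre m I F. \<forall>J. is_ideal J \<and> x \<in> J \<and> J \<subseteq> I \<longrightarrow>
              (\<forall>n\<ge>t. colon_mod scale (ideal_smult scale (ideal_pow I n) M) N J
                      = submod_sum (colon_mod scale {0} N J) (ideal_smult scale (ideal_pow I (n - 1)) M))))"
proof -
  interpret ideal_module scale I
    using assms(1,4,5) by (simp add: ideal_module_def ideal_module_axioms_def)
  interpret noetherian_local m
    using assms(1,2) by unfold_locales
  have acc: "acc (range scale) M" "acc (range scale) N"
    using assms(8,9) acc_span[OF assms(1)] unfolding fg_submodule_def by auto
  note avoid = finite_ideal_avoidance[OF assms(3,4)]
  obtain t \<V> where t: "t > 0" and \<V>: "finite \<V>" "\<forall>V\<in>\<V>. is_ideal V \<and> V \<subset> I"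
    and eq: "\<And>x J n. x \<in> I - \<Union>\<V> \<Longrightarrow> is_ideal J \<and> x \<in> J \<and> J \<subseteq> I \<Longrightarrow> n \<ge> t \<Longrightarrow>
      colon_mod scale (adic M n) N J = submod_sum (colon_mod scale {0} N J) (adic M (n - 1))"
    using colon_adic_eq[OF acc(1) assms(6) acc(2) assms(7,10) avoid] by metis
  obtain f \<W> where f: "f \<in> polyfun m I" and \<W>: "finite \<W>" "\<forall>W\<in>\<W>. is_ideal W \<and> W \<subset> I" "\<Union>\<V> \<subseteq> \<Union>\<W>"
    and fm: "\<forall>x\<in>I. f x \<notin> m \<longleftrightarrow> x \<notin> \<Union>\<W>"
    using polyfun_avoiding[OF assms(4) \<V>] by blast
  \<comment> \<open>One polynomial function is enough: the set is a principal open set. It is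
    nonempty by avoidance for \<W>, and it lies outside \<V>, where the colon formula holds.\<close>
  have open_eq: "zariski_open_pre m I {f} = I - \<Union>\<W>"
    using fm unfolding zariski_open_pre_def by auto
  show ?thesis
  proof (intro exI[of _ t] exI[of _ "{f}"] conjI ballI allI impI t)
    show "{f} \<subseteq> polyfun m I" using f by simp
    show "zariski_open_pre m I {f} \<noteq> {}" unfolding open_eq by (rule avoid[OF \<W>(1,2)])
    fix x J n assume "x \<in> zariski_open_pre m I {f}" and J: "is_ideal J \<and> x \<in> J \<and> J \<subseteq> I" and n: "t \<le> n"
    then have "x \<in> I - \<Union>\<V>" unfolding open_eq using \<W>(3) by blast
    from eq[OF this J n]
    show "colon_mod scale (ideal_smult scale (ideal_pow I n) M) N J
      = submod_sum (colon_mod scale {0} N J) (ideal_smult scale (ideal_pow I (n - 1)) M)"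
      by (simp only: adic_eq[OF assms(6)])
  qed
qed

end
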